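(* Let $G$ be a profinite MP group. Then the second derived subgroup $G^{(2)}$ of $G$ is pronilpotent.
   Context: For a profinite group $G$ and $x\in G$, let $\langle x\rangle^G$ denote the normal closure of $x$ in $G$, understood topologically: the smallest closed normal subgroup of $G$ containing $x$. A profinite group $G$ has the Magnus Property (is MP) if whenever $x,y\in G$ satisfy $\langle x\rangle^G=\langle y\rangle^G$, then $x$ is conjugate in $G$ to $y$ or to $y^{-1}$. The derived subgroups of a profinite group $G$ are defined recursively by $G^{(0)}=G$ and $G^{(n+1)}$ equal to the closure of the abstract derived subgroup of $G^{(n)}$, for $n\ge 0$. A profinite group is pronilpotent if it is an inverse limit of finite nilpotent groups. *)

theory Defs
  imports
    "HOL-Algebra.Generated_Groups"
    "HOL-Algebra.Product_Groups"
    "HOL-Analysis.Function_Topology"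
    "HOL-Analysis.Product_Topology"
begin

locale topological_group = group G for G (structure) +
  fixes T :: "'a topology"
  assumes topspace_eq: "topspace T = carrier G"
    and continuous_mult: "continuous_map (prod_topology T T) T (\<lambda>(x, y). x \<otimes> y)"
    and continuous_inv: "continuous_map T T (\<lambda>x. inv x)"

definition topological_iso ::
  "('a, 'm) monoid_scheme \<Rightarrow> 'a topology \<Rightarrow> ('b, 'n) monoid_scheme \<Rightarrow> 'b topology \<Rightarrow> ('a \<Rightarrow> 'b) \<Rightarrow> bool"
  where "topological_iso G T G' T' f \<longleftrightarrow> f \<in> iso G G' \<and> homeomorphic_map T T' f"

text \<open>The transition map \<open>\<phi> i j\<close>, for \<open>i \<preceq> j\<close>, goes from \<open>H j\<close> to \<open>H i\<close>.\<close>

locale inverse_system =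
  fixes I :: "'i set"
    and leq :: "'i \<Rightarrow> 'i \<Rightarrow> bool" (infix \<open>\<preceq>\<close> 50)
    and H :: "'i \<Rightarrow> ('b, 'n) monoid_scheme"
    and \<phi> :: "'i \<Rightarrow> 'i \<Rightarrow> 'b \<Rightarrow> 'b"
  assumes nonempty: "I \<noteq> {}"
    and partial_order: "reflp_on I (\<preceq>)" "transp_on I (\<preceq>)" "antisymp_on I (\<preceq>)"
    and directed: "\<lbrakk>i \<in> I; j \<in> I\<rbrakk> \<Longrightarrow> \<exists>k\<in>I. i \<preceq> k \<and> j \<preceq> k"
    and groups: "i \<in> I \<Longrightarrow> group (H i)"
    and transition_hom: "\<lbrakk>i \<in> I; j \<in> I; i \<preceq> j\<rbrakk> \<Longrightarrow> \<phi> i j \<in> hom (H j) (H i)"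
    and transition_id: "\<lbrakk>i \<in> I; x \<in> carrier (H i)\<rbrakk> \<Longrightarrow> \<phi> i i x = x"
    and transition_comp: "\<lbrakk>i \<in> I; j \<in> I; k \<in> I; i \<preceq> j; j \<preceq> k; x \<in> carrier (H k)\<rbrakk>
      \<Longrightarrow> \<phi> i j (\<phi> j k x) = \<phi> i k x"

definition inverse_limit_carrier ::
  "'i set \<Rightarrow> ('i \<Rightarrow> 'i \<Rightarrow> bool) \<Rightarrow> ('i \<Rightarrow> ('b, 'n) monoid_scheme) \<Rightarrow> ('i \<Rightarrow> 'i \<Rightarrow> 'b \<Rightarrow> 'b) \<Rightarrow> ('i \<Rightarrow> 'b) set"
  where "inverse_limit_carrier I leq H \<phi> =
    {x \<in> carrier (product_group I H). \<forall>i\<in>I. \<forall>j\<in>I. leq i j \<longrightarrow> \<phi> i j (x j) = x i}"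

definition inverse_limit_group ::
  "'i set \<Rightarrow> ('i \<Rightarrow> 'i \<Rightarrow> bool) \<Rightarrow> ('i \<Rightarrow> ('b, 'n) monoid_scheme) \<Rightarrow> ('i \<Rightarrow> 'i \<Rightarrow> 'b \<Rightarrow> 'b) \<Rightarrow> ('i \<Rightarrow> 'b) monoid"
  where "inverse_limit_group I leq H \<phi> =
    (product_group I H)\<lparr>carrier := inverse_limit_carrier I leq H \<phi>\<rparr>"

definition inverse_limit_topology ::
  "'i set \<Rightarrow> ('i \<Rightarrow> 'i \<Rightarrow> bool) \<Rightarrow> ('i \<Rightarrow> ('b, 'n) monoid_scheme) \<Rightarrow> ('i \<Rightarrow> 'i \<Rightarrow> 'b \<Rightarrow> 'b) \<Rightarrow> ('i \<Rightarrow> 'b) topology"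
  where "inverse_limit_topology I leq H \<phi> =
    subtopology (product_topology (\<lambda>i. discrete_topology (carrier (H i))) I)
      (inverse_limit_carrier I leq H \<phi>)"

text \<open>
  \<open>inverse_limit_of_finite P G T\<close>: the topological group \<open>(G, T)\<close> is an inverse limit of finite
  (discrete) groups satisfying \<open>P\<close>. HOL needs fixed types for the system. Every finite group is
  isomorphic to one on a set of naturals. Index sets of type \<open>'a set set\<close> suffice whenever \<open>P\<close>
  is preserved by isomorphisms, subgroups and quotients: one may then always use the open normal
  subgroups \<open>N\<close> of \<open>G\<close>, ordered by reverse inclusion, and the quotients \<open>G/N\<close>.
\<close>

definition inverse_limit_of_finite ::
  "(nat monoid \<Rightarrow> bool) \<Rightarrow> ('a, 'm) monoid_scheme \<Rightarrow> 'a topology \<Rightarrow> bool"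
  where "inverse_limit_of_finite P G T \<longleftrightarrow>
    topological_group G T \<and>
    (\<exists>(I :: 'a set set) leq (H :: 'a set \<Rightarrow> nat monoid) \<phi> f.
      inverse_system I leq H \<phi> \<and>
      (\<forall>i\<in>I. finite (carrier (H i)) \<and> P (H i)) \<and>
      topological_iso G T (inverse_limit_group I leq H \<phi>) (inverse_limit_topology I leq H \<phi>) f)"

primrec lower_central :: "('a, 'm) monoid_scheme \<Rightarrow> nat \<Rightarrow> 'a set" where
  "lower_central G 0 = carrier G"
| "lower_central G (Suc n) = generate G
    {x \<otimes>\<^bsub>G\<^esub> y \<otimes>\<^bsub>G\<^esub> inv\<^bsub>G\<^esub> x \<otimes>\<^bsub>G\<^esub> inv\<^bsub>G\<^esub> y | x y. x \<in> lower_central G n \<and> y \<in> carrier G}"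

definition nilpotent_group :: "('a, 'm) monoid_scheme \<Rightarrow> bool"
  where "nilpotent_group G \<longleftrightarrow> group G \<and> (\<exists>n. lower_central G n = {\<one>\<^bsub>G\<^esub>})"

definition profinite_group :: "('a, 'm) monoid_scheme \<Rightarrow> 'a topology \<Rightarrow> bool"
  where "profinite_group G T \<longleftrightarrow> inverse_limit_of_finite (\<lambda>_. True) G T"

definition pronilpotent_group :: "('a, 'm) monoid_scheme \<Rightarrow> 'a topology \<Rightarrow> bool"
  where "pronilpotent_group G T \<longleftrightarrow>
    profinite_group G T \<and> inverse_limit_of_finite nilpotent_group G T"

definition closed_normal_closure :: "('a, 'm) monoid_scheme \<Rightarrow> 'a topology \<Rightarrow> 'a \<Rightarrow> 'a set"
  where "closed_normal_closure G T x = \<Inter>{N. N \<lhd> G \<and> closedin T N \<and> x \<in> N}"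

definition conjugate_in :: "('a, 'm) monoid_scheme \<Rightarrow> 'a \<Rightarrow> 'a \<Rightarrow> bool"
  where "conjugate_in G x y \<longleftrightarrow> (\<exists>g\<in>carrier G. y = g \<otimes>\<^bsub>G\<^esub> x \<otimes>\<^bsub>G\<^esub> inv\<^bsub>G\<^esub> g)"

definition magnus_property :: "('a, 'm) monoid_scheme \<Rightarrow> 'a topology \<Rightarrow> bool"
  where "magnus_property G T \<longleftrightarrow>
    (\<forall>x\<in>carrier G. \<forall>y\<in>carrier G.
      closed_normal_closure G T x = closed_normal_closure G T y \<longrightarrow>
      conjugate_in G x y \<or> conjugate_in G x (inv\<^bsub>G\<^esub> y))"

text \<open>The closure is taken in \<open>G\<close>; as each term of the series is closed in \<open>G\<close>, this agrees with
  the closure taken inside the preceding term.\<close>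

primrec closed_derived :: "('a, 'm) monoid_scheme \<Rightarrow> 'a topology \<Rightarrow> nat \<Rightarrow> 'a set" where
  "closed_derived G T 0 = carrier G"
| "closed_derived G T (Suc n) = T closure_of (derived G (closed_derived G T n))"

end

theory Submission
  imports Defs
    "HOL-Algebra.Sylow"
    "HOL-Algebra.Multiplicative_Group"
    "HOL-Algebra.Group_Action"
    "HOL-Number_Theory.Cong"
    "HOL-Analysis.Abstract_Topological_Spaces"
begin

text \<open>The Magnus Property passes from \<open>G\<close> to its finite continuous images, because elements with equal
  normal closures in the image lift to elements with equal closures in \<open>G\<close>. So it is enough to show
  that \<open>G\<^sup>(\<^sup>2\<^sup>)\<close> is nilpotent for a finite group \<open>G\<close> with the Magnus Property, that is, that it centralizes
  every chief factor \<open>V\<close>. In a quotient we may take \<open>V\<close> minimal normal. Then all nontrivial elements of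
  \<open>V\<close> are conjugate up to inversion, hence \<open>V\<close> is an elementary abelian \<open>p\<close>-group and the group
  \<open>H = G / C(V)\<close> together with \<open>-1\<close> is transitive on the nonzero vectors of \<open>V\<close>. By this transitivity an
  abelian normal subgroup of \<open>H\<close> acts freely on the nonzero vectors, so it has at most one subgroup of
  each prime order. Let \<open>A\<close> be a maximal abelian normal subgroup of \<open>H\<close>. If \<open>A\<close> is its own centralizer,
  then \<open>H / A\<close> acts on \<open>A\<close> by power maps, which commute, so \<open>H\<close> is metabelian and \<open>G\<^sup>(\<^sup>2\<^sup>)\<close> centralizes \<open>V\<close>.
  Otherwise the centralizer contains a chief factor \<open>U / A\<close> of \<open>H\<close> of exponent \<open>r\<close> with \<open>U\<close> nonabelian, and a
  commutator \<open>z \<noteq> 1\<close> of \<open>U\<close> has order \<open>r\<close>. If an element \<open>x\<close> of order prime to \<open>r\<close> centralizes \<open>z\<close> but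
  not \<open>U / A\<close>, then \<open>x\<close> and \<open>x z\<close> have the same normal closure but different orders, which contradicts
  the Magnus Property of \<open>H\<close>. Hence the centralizer of \<open>z\<close> acts on \<open>U / A\<close> as an \<open>r\<close>-group and fixes a
  nontrivial element there. Its orbit has at most \<open>r - 1\<close> elements, yet up to inversion it is everything
  but the identity; this forces \<open>U / A\<close> to be cyclic and \<open>U\<close> to be abelian.\<close>

section \<open>Images of groups with the Magnus Property\<close>

text \<open>Complementation reverses inclusion, so Zorn's lemma for maximal elements, applied to the
  complements of the members of \<open>F\<close>, gives a minimal member.\<close>

lemma subset_Zorn_minimal:
  assumes "F \<noteq> {}"
    and chain: "\<And>\<C>. \<C> \<noteq> {} \<Longrightarrow> \<C> \<subseteq> F \<Longrightarrow> (\<And>A B. A \<in> \<C> \<Longrightarrow> B \<in> \<C> \<Longrightarrow> A \<subseteq> B \<or> B \<subseteq> A)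
      \<Longrightarrow> \<Inter>\<C> \<in> F"
  shows "\<exists>M\<in>F. \<forall>X\<in>F. X \<subseteq> M \<longrightarrow> X = M"
proof -
  have "\<exists>M\<in>uminus ` F. \<forall>X\<in>uminus ` F. M \<subseteq> X \<longrightarrow> X = M"
  proof (rule subset_Zorn_nonempty)
    fix \<C> assume "\<C> \<noteq> {}" and ch: "subset.chain (uminus ` F) \<C>"
    have "\<Inter>(uminus ` \<C>) \<in> F"
    proof (rule chain)
      show "uminus ` \<C> \<noteq> {}" by (simp add: \<open>\<C> \<noteq> {}\<close>)
      show "uminus ` \<C> \<subseteq> F" using ch unfolding subset_chain_def by auto
      fix A B assume "A \<in> uminus ` \<C>" "B \<in> uminus ` \<C>"
      then have "- A \<in> \<C>" "- B \<in> \<C>" by auto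
      then have "- A \<subseteq> - B \<or> - B \<subseteq> - A"
        using ch unfolding subset_chain_def by meson
      then show "A \<subseteq> B \<or> B \<subseteq> A" by blast
    qed
    moreover have "\<Union>\<C> = - \<Inter>(uminus ` \<C>)" by auto
    ultimately show "\<Union>\<C> \<in> uminus ` F" by (simp add: image_iff bexI[of _ "\<Inter>(uminus ` \<C>)"])
  qed (use assms(1) in simp)
  then obtain M where M: "M \<in> F" "\<forall>X\<in>F. - M \<subseteq> - X \<longrightarrow> - X = - M"
    by (auto simp del: Compl_subset_Compl_iff compl_le_compl_iff)
  have "X = M" if "X \<in> F" "X \<subseteq> M" for X
    using M(2) that by (metis Compl_anti_mono double_complement)
  with M(1) show ?thesis by blast
qed

lemma (in group) normal_Inter:
  assumes "\<N> \<noteq> {}" "\<And>N. N \<in> \<N> \<Longrightarrow> N \<lhd> G"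
  shows "\<Inter>\<N> \<lhd> G"
proof -
  have "subgroup (\<Inter>\<N>) G"
    using assms by (intro subgroups_Inter) (auto dest: normal_imp_subgroup)
  moreover have "x \<otimes> h \<otimes> inv x \<in> \<Inter>\<N>" if "x \<in> carrier G" "h \<in> \<Inter>\<N>" for x h
    using that assms(2) normal.inv_op_closed2 by fastforce
  ultimately show ?thesis
    by (simp add: normal_inv_iff)
qed

lemma (in group_hom) surj_img_normal:
  assumes "N \<lhd> G" "h ` carrier G = carrier H"
  shows "h ` N \<lhd> H"
  using assms normal.surj_hom_normal_subgroup group_hom_axioms by blast

lemma (in group_hom) vimage_normal:
  assumes "N \<lhd> H"
  shows "{x \<in> carrier G. h x \<in> N} \<lhd> G"
proof -
  interpret N: normal N H by fact
  have "subgroup {x \<in> carrier G. h x \<in> N} G"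
    by (unfold_locales) auto
  moreover have "x \<otimes> y \<otimes> inv x \<in> {x \<in> carrier G. h x \<in> N}"
    if "x \<in> carrier G" "y \<in> {x \<in> carrier G. h x \<in> N}" for x y
    using that N.inv_op_closed2[of "h x" "h y"] by simp
  ultimately show ?thesis
    by (simp add: G.normal_inv_iff)
qed

lemma (in topological_group) closed_normal_closure_props:
  assumes "x \<in> carrier G"
  shows "closed_normal_closure G T x \<lhd> G" "closedin T (closed_normal_closure G T x)"
    "x \<in> closed_normal_closure G T x"
proof -
  have "carrier G \<in> {N. N \<lhd> G \<and> closedin T N \<and> x \<in> N}"
    using assms normal_self topspace_eq by (metis closedin_topspace mem_Collect_eq)
  then show "closed_normal_closure G T x \<lhd> G" "closedin T (closed_normal_closure G T x)"
    "x \<in> closed_normal_closure G T x"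
    unfolding closed_normal_closure_def by (auto intro!: normal_Inter closedin_Inter)
qed

lemma closed_normal_closure_least:
  "\<lbrakk>N \<lhd> G; closedin T N; x \<in> N\<rbrakk> \<Longrightarrow> closed_normal_closure G T x \<subseteq> N"
  unfolding closed_normal_closure_def by blast

lemma discrete_topological_group:
  assumes "group G"
  shows "topological_group G (discrete_topology (carrier G))"
proof -
  interpret group G by fact
  show ?thesis
    by unfold_locales
      (auto simp flip: prod_topology_discrete_topology)
qed

text \<open>The closure of an element is an intersection of normal subgroups, so elements that lie
  in the same normal subgroups have equal closures. In this form the Magnus Property is applied to
  elements of finite groups.\<close>

lemma magnus_discreteD:
  fixes G (structure)
  assumes "magnus_property G (discrete_topology (carrier G))"
    and "x \<in> carrier G" "y \<in> carrier G" "\<And>N. N \<lhd> G \<Longrightarrow> x \<in> N \<longleftrightarrow> y \<in> N"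
  shows "\<exists>g\<in>carrier G. y = g \<otimes> x \<otimes> inv g \<or> inv y = g \<otimes> x \<otimes> inv g"
proof -
  have "closed_normal_closure G (discrete_topology (carrier G)) x
      = closed_normal_closure G (discrete_topology (carrier G)) y"
    unfolding closed_normal_closure_def using assms(4) by (metis (no_types, lifting))
  then show ?thesis
    using assms(1-3) unfolding magnus_property_def conjugate_in_def by blast
qed

text \<open>A minimal closed normal subgroup of \<open>G\<close> that maps onto the common closure of \<open>x\<close> and \<open>y\<close> is the
  closure of every preimage of \<open>x\<close> or \<open>y\<close> that it contains.\<close>

lemma magnus_property_image:
  assumes "topological_group G T" "compact_space T" "magnus_property G T"
    and "group_hom G Q f" "f ` carrier G = carrier Q"
    and "continuous_map T (discrete_topology (carrier Q)) f"
  shows "magnus_property Q (discrete_topology (carrier Q))"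
  unfolding magnus_property_def
proof (intro ballI impI)
  interpret G: topological_group G T by fact
  interpret f: group_hom G Q f by fact
  interpret Q: topological_group Q "discrete_topology (carrier Q)"
    by (rule discrete_topological_group) (rule f.H.is_group)
  fix x y
  assume x: "x \<in> carrier Q" and y: "y \<in> carrier Q"
    and eq: "closed_normal_closure Q (discrete_topology (carrier Q)) x
      = closed_normal_closure Q (discrete_topology (carrier Q)) y"
  define K where "K = closed_normal_closure Q (discrete_topology (carrier Q)) x"
  have K: "K \<lhd> Q" "x \<in> K" "y \<in> K"
    unfolding K_def using Q.closed_normal_closure_props x y eq by auto
  then have Ksub: "K \<subseteq> carrier Q"
    by (meson normal_imp_subgroup subgroup.subset)
  have Kmin: "K \<subseteq> N" if "N \<lhd> Q" "x \<in> N \<or> y \<in> N" for N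
  proof -
    have "N \<subseteq> carrier Q"
      using that by (meson normal_imp_subgroup subgroup.subset)
    then show ?thesis
      unfolding K_def using that eq
      by (metis closed_normal_closure_least closedin_discrete_topology)
  qed
  have closed_fibre: "closedin T {g \<in> carrier G. f g \<in> S}" if "S \<subseteq> carrier Q" for S
    using closedin_continuous_map_preimage[OF assms(6), of S] that
    by (simp add: G.topspace_eq)
  define F where "F = {B. B \<lhd> G \<and> closedin T B \<and> f ` B = K}"
  have "{g \<in> carrier G. f g \<in> K} \<in> F"
    unfolding F_def using f.vimage_normal[OF K(1)] closed_fibre[OF Ksub] Ksub assms(5)
    by (auto simp: image_iff subset_eq)
  then have nonempty: "F \<noteq> {}" by blast
  have chain: "\<Inter>\<C> \<in> F" if ne: "\<C> \<noteq> {}" and sub: "\<C> \<subseteq> F"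
    and ch: "\<And>A B. A \<in> \<C> \<Longrightarrow> B \<in> \<C> \<Longrightarrow> A \<subseteq> B \<or> B \<subseteq> A" for \<C>
  proof -
    have "K \<subseteq> f ` \<Inter>\<C>"
    proof
      fix q assume q: "q \<in> K"
      \<comment> \<open>The fibres over \<open>q\<close> in the members of the chain are closed,
        nonempty and totally ordered by inclusion. Compactness yields a common point, so the
        intersection still maps onto \<open>K\<close>.\<close>
      define \<U> where "\<U> = (\<lambda>B. B \<inter> {g \<in> carrier G. f g \<in> {q}}) ` \<C>"
      have closed: "closedin T U" if "U \<in> \<U>" for U
        using that sub closed_fibre[of "{q}"] q Ksub unfolding \<U>_def F_def by auto
      have "\<Inter>\<F> \<noteq> {}" if fin: "finite \<F>" "\<F> \<subseteq> \<U>" for \<F>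
      proof (cases "\<F> = {}")
        case False
        have "subset.chain UNIV \<F>"
          using fin ch unfolding subset_chain_def \<U>_def by blast
        then have "\<Inter>\<F> \<in> \<F>"
          using Inter_in_chain fin False by blast
        then obtain B where B: "B \<in> \<C>" "\<Inter>\<F> = B \<inter> {g \<in> carrier G. f g \<in> {q}}"
          using fin unfolding \<U>_def by blast
        have "B \<lhd> G" "f ` B = K"
          using B(1) sub unfolding F_def by blast+
        then obtain b where b: "b \<in> B" "f b = q"
          using q by blast
        moreover have "b \<in> carrier G"
          using \<open>B \<lhd> G\<close> b(1) by (meson normal_imp_subgroup subgroup.mem_carrier)
        ultimately have "b \<in> \<Inter>\<F>"
          by (simp only: B(2)) simp
        then show ?thesis by blast
      qed simp
      then have "\<Inter>\<U> \<noteq> {}"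
        using assms(2) closed unfolding compact_space_fip by (metis (no_types, lifting))
      then obtain b where b: "\<And>B. B \<in> \<C> \<Longrightarrow> b \<in> B \<and> f b = q"
        unfolding \<U>_def by blast
      then have "b \<in> \<Inter>\<C>" "f b = q"
        using ne by blast+
      then show "q \<in> f ` \<Inter>\<C>"
        by blast
    qed
    moreover have "f ` \<Inter>\<C> \<subseteq> K"
      using ne sub unfolding F_def by blast
    moreover have "\<Inter>\<C> \<lhd> G" "closedin T (\<Inter>\<C>)"
      using ne sub unfolding F_def by (auto intro!: G.normal_Inter closedin_Inter)
    ultimately show ?thesis
      unfolding F_def by blast
  qed
  obtain B where B: "B \<in> F" "\<And>X. X \<in> F \<Longrightarrow> X \<subseteq> B \<Longrightarrow> X = B"
    using subset_Zorn_minimal[of F, OF nonempty chain] by metis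
  have Bsub: "B \<subseteq> carrier G" and fB: "f ` B = K" and "B \<lhd> G" "closedin T B"
    using B(1) unfolding F_def by (simp_all, meson normal_imp_subgroup subgroup.subset)
  have closure_B: "closed_normal_closure G T b = B" if b: "b \<in> B" "f b = x \<or> f b = y" for b
  proof -
    have sub: "closed_normal_closure G T b \<subseteq> B"
      by (rule closed_normal_closure_least) fact+
    have bG: "b \<in> carrier G" using b Bsub by blast
    note props = G.closed_normal_closure_props[OF bG]
    \<comment> \<open>The image is normal because \<open>f\<close> is onto, and it contains
      \<open>x\<close> or \<open>y\<close>, so it is all of \<open>K\<close>. Hence the closure of
      \<open>b\<close> belongs to \<open>F\<close> and the minimality of \<open>B\<close>
      applies.\<close>
    have "f ` closed_normal_closure G T b \<lhd> Q"
      using f.surj_img_normal[OF props(1) assms(5)] .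
    then have "K \<subseteq> f ` closed_normal_closure G T b"
      using b props(3) by (intro Kmin) (blast | metis image_eqI)+
    then have "f ` closed_normal_closure G T b = K"
      using sub fB by blast
    then show ?thesis
      using B(2) sub props(1,2) unfolding F_def by (metis (mono_tags, lifting) mem_Collect_eq)
  qed
  obtain x' y' where x': "x' \<in> B" "f x' = x" and y': "y' \<in> B" "f y' = y"
    using K fB by blast
  then have "closed_normal_closure G T x' = closed_normal_closure G T y'"
    using closure_B by simp
  then have "conjugate_in G x' y' \<or> conjugate_in G x' (inv\<^bsub>G\<^esub> y')"
    using assms(3) x' y' Bsub unfolding magnus_property_def by (meson subsetD)
  moreover have "conjugate_in Q (f u) (f v)" if "conjugate_in G u v" "u \<in> carrier G" for u v
    using that unfolding conjugate_in_def by (auto intro!: bexI[of _ "f _"])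
  ultimately show "conjugate_in Q x y \<or> conjugate_in Q x (inv\<^bsub>Q\<^esub> y)"
    using x' y' Bsub by (metis f.hom_inv subsetD)
qed

lemma magnus_discrete_image:
  assumes "finite (carrier G)" "magnus_property G (discrete_topology (carrier G))"
    and "group_hom G Q f" "f ` carrier G = carrier Q"
  shows "magnus_property Q (discrete_topology (carrier Q))"
proof (rule magnus_property_image[OF _ _ assms(2-4)])
  show "topological_group G (discrete_topology (carrier G))"
    using assms(3) by (intro discrete_topological_group) (simp add: group_hom_def)
  show "continuous_map (discrete_topology (carrier G)) (discrete_topology (carrier Q)) f"
    using assms(4) by auto
qed (use assms(1) in \<open>simp add: compact_space_discrete_topology\<close>)

section \<open>Minimal normal subgroups\<close>

locale finite_magnus_group = group G for G (structure) +
  assumes finite_carrier: "finite (carrier G)"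
    and magnus: "magnus_property G (discrete_topology (carrier G))"

lemma (in finite_magnus_group) finite_magnus_image:
  assumes "group_hom G Q f" "f ` carrier G = carrier Q"
  shows "finite_magnus_group Q"
proof -
  interpret f: group_hom G Q f by fact
  show ?thesis
    using magnus_discrete_image[OF finite_carrier magnus assms] finite_carrier assms(2)
    by unfold_locales (metis finite_imageI)
qed

definition minimal_normal :: "('a, 'm) monoid_scheme \<Rightarrow> 'a set \<Rightarrow> bool"
  where "minimal_normal G V \<longleftrightarrow> V \<lhd> G \<and> V \<noteq> {\<one>\<^bsub>G\<^esub>} \<and>
    (\<forall>N. N \<lhd> G \<longrightarrow> N \<subseteq> V \<longrightarrow> N = {\<one>\<^bsub>G\<^esub>} \<or> N = V)"

section \<open>Conjugation as an action by automorphisms\<close>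

context group
begin

lemma cancel_inv:
  assumes "x \<in> carrier G" "y \<in> carrier G"
  shows "x \<otimes> (inv x \<otimes> y) = y" "inv x \<otimes> (x \<otimes> y) = y"
  using assms by (simp_all flip: m_assoc)

definition conj_by :: "'a \<Rightarrow> 'a \<Rightarrow> 'a"
  where "conj_by g x = g \<otimes> x \<otimes> inv g"

lemma conj_closed [simp]: "g \<in> carrier G \<Longrightarrow> x \<in> carrier G \<Longrightarrow> conj_by g x \<in> carrier G"
  by (simp add: conj_by_def)

lemma conj_one [simp]: "x \<in> carrier G \<Longrightarrow> conj_by \<one> x = x" "g \<in> carrier G \<Longrightarrow> conj_by g \<one> = \<one>"
  by (simp_all add: conj_by_def)

lemma conj_mult:
  "g \<in> carrier G \<Longrightarrow> x \<in> carrier G \<Longrightarrow> y \<in> carrier G \<Longrightarrow> conj_by g (x \<otimes> y) = conj_by g x \<otimes> conj_by g y"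
  by (simp add: conj_by_def m_assoc cancel_inv)

lemma conj_inv: "g \<in> carrier G \<Longrightarrow> x \<in> carrier G \<Longrightarrow> conj_by g (inv x) = inv (conj_by g x)"
  by (simp add: conj_by_def m_assoc inv_mult_group)

lemma conj_pow:
  "g \<in> carrier G \<Longrightarrow> x \<in> carrier G \<Longrightarrow> conj_by g (x [^] (n::nat)) = conj_by g x [^] n"
  by (induction n) (simp_all add: conj_mult)

lemma conj_comp:
  "g \<in> carrier G \<Longrightarrow> h \<in> carrier G \<Longrightarrow> x \<in> carrier G \<Longrightarrow> conj_by (g \<otimes> h) x = conj_by g (conj_by h x)"
  by (simp add: conj_by_def m_assoc inv_mult_group)

lemma conj_inv_cancel:
  assumes "g \<in> carrier G" "x \<in> carrier G"
  shows "conj_by (inv g) (conj_by g x) = x" "conj_by g (conj_by (inv g) x) = x"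
  using assms by (simp_all flip: conj_comp)

lemma conj_fix_iff:
  "g \<in> carrier G \<Longrightarrow> x \<in> carrier G \<Longrightarrow> conj_by g x = x \<longleftrightarrow> g \<otimes> x = x \<otimes> g"
  by (metis conj_by_def inv_solve_right' m_closed)

lemma conj_fix_sym:
  "g \<in> carrier G \<Longrightarrow> x \<in> carrier G \<Longrightarrow> conj_by g x = x \<longleftrightarrow> conj_by x g = g"
  by (auto simp: conj_fix_iff)

lemma conj_fix_inv:
  "g \<in> carrier G \<Longrightarrow> x \<in> carrier G \<Longrightarrow> conj_by g x = x \<Longrightarrow> conj_by (inv g) x = x"
  by (metis conj_inv_cancel(1))

lemma conj_fix_pow:
  "g \<in> carrier G \<Longrightarrow> x \<in> carrier G \<Longrightarrow> conj_by g x = x \<Longrightarrow> conj_by (g [^] (n::nat)) x = x"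
  by (induction n) (simp_all add: conj_comp)

text \<open>Holds because conjugation by \<open>g\<close> is an automorphism; it moves stabilizers
  and centralizers along \<open>g\<close>.\<close>

lemma conj_conj:
  "g \<in> carrier G \<Longrightarrow> h \<in> carrier G \<Longrightarrow> x \<in> carrier G
    \<Longrightarrow> conj_by g (conj_by h x) = conj_by (conj_by g h) (conj_by g x)"
  by (simp add: conj_by_def m_assoc inv_mult_group cancel_inv)

lemma conj_ord: "g \<in> carrier G \<Longrightarrow> x \<in> carrier G \<Longrightarrow> ord (conj_by g x) = ord x"
  by (rule ord_unique[THEN iffD2]) (auto simp: pow_eq_id simp flip: conj_pow,
      metis conj_inv_cancel(1) conj_one(2) inv_closed nat_pow_closed pow_eq_id, metis conj_one(2) pow_eq_id)

lemma normal_in_carrier: "N \<lhd> G \<Longrightarrow> x \<in> N \<Longrightarrow> x \<in> carrier G"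
  by (meson normal_imp_subgroup subgroup.mem_carrier)

lemma normal_conj: "N \<lhd> G \<Longrightarrow> x \<in> N \<Longrightarrow> g \<in> carrier G \<Longrightarrow> conj_by g x \<in> N"
  unfolding conj_by_def by (rule normal.inv_op_closed2)

lemma normal_mult: "N \<lhd> G \<Longrightarrow> x \<in> N \<Longrightarrow> y \<in> N \<Longrightarrow> x \<otimes> y \<in> N"
  by (meson normal_imp_subgroup subgroup.m_closed)

lemma normal_inv: "N \<lhd> G \<Longrightarrow> x \<in> N \<Longrightarrow> inv x \<in> N"
  by (meson normal_imp_subgroup subgroup.m_inv_closed)

lemma normal_one: "N \<lhd> G \<Longrightarrow> \<one> \<in> N"
  by (meson normal_imp_subgroup subgroup.one_closed)

lemma normal_pow: "N \<lhd> G \<Longrightarrow> x \<in> N \<Longrightarrow> x [^] (n::nat) \<in> N"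
  by (induction n) (auto intro: normal_mult normal_one)

lemma normalI':
  assumes "N \<subseteq> carrier G" "\<one> \<in> N" "\<And>x y. x \<in> N \<Longrightarrow> y \<in> N \<Longrightarrow> x \<otimes> y \<in> N"
    "\<And>x. x \<in> N \<Longrightarrow> inv x \<in> N"
    "\<And>g x. g \<in> carrier G \<Longrightarrow> x \<in> N \<Longrightarrow> conj_by g x \<in> N"
  shows "N \<lhd> G"
proof -
  have "subgroup N G"
    using assms by unfold_locales auto
  then show ?thesis
    using assms(5) by (simp add: normal_inv_iff conj_by_def)
qed

end

section \<open>Fixed points of p-groups\<close>

text \<open>A point that is not fixed has an orbit whose size divides \<open>p ^ a\<close> and is
  not 1, hence is a multiple of \<open>p\<close>. These orbits partition the complement of the fixed
  points.\<close>

lemma p_group_fixed_points: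
  assumes "group R" "order R = p ^ a" "prime p" "finite X"
    and closed: "\<And>g x. g \<in> carrier R \<Longrightarrow> x \<in> X \<Longrightarrow> \<phi> g x \<in> X"
    and one: "\<And>x. x \<in> X \<Longrightarrow> \<phi> \<one>\<^bsub>R\<^esub> x = x"
    and mult: "\<And>g h x. g \<in> carrier R \<Longrightarrow> h \<in> carrier R \<Longrightarrow> x \<in> X \<Longrightarrow> \<phi> (g \<otimes>\<^bsub>R\<^esub> h) x = \<phi> g (\<phi> h x)"
    and dvd: "p dvd card X"
  shows "p dvd card {x \<in> X. \<forall>g\<in>carrier R. \<phi> g x = x}"
proof -
  interpret R: group R by fact
  \<comment> \<open>Elements of \<open>Bij X\<close> must be extensional, hence the restriction to
    \<open>X\<close>.\<close>
  define \<psi> where "\<psi> g = restrict (\<phi> g) X" for g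
  have bij: "bij_betw (\<phi> g) X X" if g: "g \<in> carrier R" for g
  proof (rule bij_betw_byWitness[where f' = "\<phi> (inv\<^bsub>R\<^esub> g)"])
    show "\<forall>x\<in>X. \<phi> (inv\<^bsub>R\<^esub> g) (\<phi> g x) = x" "\<forall>x\<in>X. \<phi> g (\<phi> (inv\<^bsub>R\<^esub> g) x) = x"
      using g by (simp_all add: one flip: mult)
  qed (use g closed in auto)
  have "\<psi> g \<in> Bij X" if "g \<in> carrier R" for g
    using bij[OF that] unfolding Bij_def \<psi>_def by (auto simp: bij_betw_restrict_eq)
  moreover have "\<psi> (g \<otimes>\<^bsub>R\<^esub> h) = compose X (\<psi> g) (\<psi> h)" if "g \<in> carrier R" "h \<in> carrier R" for g h
    using that closed mult by (auto simp: \<psi>_def compose_def fun_eq_iff)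
  ultimately have "\<psi> \<in> hom R (BijGroup X)"
    by (auto simp: hom_def BijGroup_def)
  then interpret group_action R X \<psi>
    by (simp add: group_action_def group_hom_def group_hom_axioms_def group_BijGroup \<open>group R\<close>)
  define F where "F = {x \<in> X. \<forall>g\<in>carrier R. \<phi> g x = x}"
  define C where "C = orbit R \<psi> ` (X - F)"
  have self: "x \<in> orbit R \<psi> x" if "x \<in> X" for x
    using orbit_refl that .
  have orb_X: "orbit R \<psi> x \<subseteq> X" if "x \<in> X" for x
    using that closed by (auto simp: orbit_def \<psi>_def)
  have orb_F: "x \<in> F" if "x \<in> X" "y \<in> orbit R \<psi> x" "y \<in> F" for x y
  proof -
    have "x \<in> orbit R \<psi> y"
      using orbit_sym orb_X that by blast
    then show ?thesis
      using \<open>y \<in> F\<close> by (auto simp: orbit_def \<psi>_def F_def)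
  qed
  have "\<Union>C = X - F"
    using self orb_X orb_F unfolding C_def by blast
  moreover have "p dvd card (\<Union>C)"
  proof (rule dvd_partition)
    show "\<forall>c\<in>C. p dvd card c"
    proof
      fix c assume "c \<in> C"
      then obtain x where x: "x \<in> X" "x \<notin> F" "c = orbit R \<psi> x"
        unfolding C_def by blast
      then obtain g where g: "g \<in> carrier R" "\<phi> g x \<noteq> x"
        unfolding F_def by blast
      have fin: "finite c"
        using x orb_X \<open>finite X\<close> finite_subset by metis
      have "card c dvd p ^ a"
        using orbit_stabilizer_theorem[OF x(1)] x(3) assms(2) by (metis dvd_triv_left)
      moreover have "card c \<noteq> 1"
      proof
        assume "card c = 1"
        then obtain z where "c = {z}" using card_1_singletonE by blast
        moreover have "\<phi> g x \<in> c" "x \<in> c"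
          using x g self by (auto simp: orbit_def \<psi>_def)
        ultimately show False using g by simp
      qed
      ultimately show "p dvd card c"
        using \<open>prime p\<close> by (metis divides_primepow_nat dvd_power not_gr_zero power_0)
    qed
    show "\<forall>c1\<in>C. \<forall>c2\<in>C. c1 \<noteq> c2 \<longrightarrow> c1 \<inter> c2 = {}"
      using disjoint_union unfolding C_def orbits_def by blast
    show "finite (\<Union>C)"
      using calculation \<open>finite X\<close> by simp
  qed
  ultimately have "p dvd card (X - F)" by simp
  moreover have "card X = card (X - F) + card F"
    using \<open>finite X\<close> F_def by (metis (no_types, lifting) card_Diff_subset card_mono finite_subset
        le_add_diff_inverse2 mem_Collect_eq subsetI)
  ultimately show ?thesis
    using dvd F_def by (metis dvd_add_right_iff)
qed

text \<open>The number of fixed points is a multiple of \<open>p\<close>, and \<open>x0\<close>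
  makes it nonzero, so there is a second one.\<close>

lemma p_group_nontrivial_fixed_point:
  assumes "group R" "order R = p ^ a" "prime p" "finite X"
    and "\<And>g x. g \<in> carrier R \<Longrightarrow> x \<in> X \<Longrightarrow> \<phi> g x \<in> X"
    and "\<And>x. x \<in> X \<Longrightarrow> \<phi> \<one>\<^bsub>R\<^esub> x = x"
    and "\<And>g h x. g \<in> carrier R \<Longrightarrow> h \<in> carrier R \<Longrightarrow> x \<in> X \<Longrightarrow> \<phi> (g \<otimes>\<^bsub>R\<^esub> h) x = \<phi> g (\<phi> h x)"
    and "p dvd card X" and x0: "x0 \<in> X" "\<And>g. g \<in> carrier R \<Longrightarrow> \<phi> g x0 = x0"
  shows "\<exists>x\<in>X. x \<noteq> x0 \<and> (\<forall>g\<in>carrier R. \<phi> g x = x)"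
proof (rule ccontr)
  assume "\<not> ?thesis"
  then have "{x \<in> X. \<forall>g\<in>carrier R. \<phi> g x = x} = {x0}"
    using x0 by blast
  moreover have "p dvd card {x \<in> X. \<forall>g\<in>carrier R. \<phi> g x = x}"
    by (rule p_group_fixed_points[of R p a X \<phi>]) (use assms in auto)
  ultimately show False
    using \<open>prime p\<close> by (simp add: prime_nat_iff)
qed

lemma nat_is_prime_power:
  fixes n p :: nat
  assumes "n > 0" "prime p" "\<And>q. prime q \<Longrightarrow> q dvd n \<Longrightarrow> q = p"
  shows "\<exists>a. n = p ^ a"
proof -
  have "n \<noteq> 0" "\<not> is_unit p" using assms by auto
  then obtain m where m: "n = p ^ multiplicity p n * m" "\<not> p dvd m"
    using multiplicity_decompose' by blast
  then have "m = 1"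
    using assms(3) by (metis dvd_mult prime_factor_nat)
  with m(1) show ?thesis by auto
qed

text \<open>If a prime \<open>q\<close> divides \<open>card V\<close>, then \<open>V\<close> has an
  element of order \<open>q\<close>, and \<open>pow\<close> makes \<open>q\<close> divide a power of
  \<open>p\<close>.\<close>

lemma (in group) card_subgroup_prime_power:
  assumes V: "subgroup V G" "finite V" and "prime p"
    and pow: "\<And>v. v \<in> V \<Longrightarrow> \<exists>k. v [^] (p ^ k :: nat) = \<one>"
  shows "\<exists>a. card V = p ^ a"
proof (rule nat_is_prime_power)
  show "card V > 0"
    using V subgroup.one_closed[OF V(1)] by (auto simp: card_gt_0_iff)
  fix q :: nat assume q: "prime q" "q dvd card V"
  interpret V: group "G\<lparr>carrier := V\<rparr>"
    by (rule subgroup_imp_group) fact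
  \<comment> \<open>Sylow's theorem with exponent 1 serves as Cauchy's theorem.\<close>
  obtain H where H: "subgroup H (G\<lparr>carrier := V\<rparr>)" "card H = q ^ 1"
    using q V.is_group V(2) sylow_thm[of q "G\<lparr>carrier := V\<rparr>" 1 "card V div q"]
    by (auto simp: order_def)
  have HG: "subgroup H G"
    using H(1) V(1) incl_subgroup by blast
  interpret H: group "G\<lparr>carrier := H\<rparr>"
    by (rule subgroup_imp_group) fact
  have "H \<noteq> {\<one>}"
    using H(2) q(1) by (auto simp: prime_nat_iff)
  then obtain x where x: "x \<in> H" "x \<noteq> \<one>"
    using HG subgroup.one_closed by blast
  have xG: "x \<in> carrier G" using subgroup.mem_carrier[OF HG x(1)] .
  have "x [^] q = \<one>"
    using H.pow_order_eq_1[of x] x H(2) by (simp add: order_def flip: nat_pow_consistent)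
  then have "ord x dvd q"
    using xG by (simp add: pow_eq_id)
  moreover obtain k where "x [^] (p ^ k :: nat) = \<one>"
    using pow x H(1) subgroup.subset by fastforce
  then have "ord x dvd p ^ k"
    using xG by (simp add: pow_eq_id)
  moreover have "ord x \<noteq> 1"
    using x xG ord_eq_1 by blast
  ultimately have "ord x = q" "ord x dvd p ^ k"
    using q(1) prime_nat_iff by auto
  then show "q = p"
    using q(1) \<open>prime p\<close> prime_dvd_power primes_dvd_imp_eq by blast
qed fact

section \<open>Consequences of the Magnus Property for minimal normal subgroups\<close>

text \<open>A normal subgroup meets \<open>V\<close> in the trivial group or in \<open>V\<close>, so
  all nontrivial elements of \<open>V\<close> lie in the same normal subgroups and the Magnus
  Property applies.\<close>

lemma (in finite_magnus_group) minimal_normal_conj: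
  assumes "minimal_normal G V" "v \<in> V" "v \<noteq> \<one>" "w \<in> V" "w \<noteq> \<one>"
  shows "\<exists>g\<in>carrier G. w = conj_by g v \<or> inv w = conj_by g v"
  unfolding conj_by_def
proof (rule magnus_discreteD[OF magnus])
  have V: "V \<lhd> G" and min: "\<And>N. N \<lhd> G \<Longrightarrow> N \<subseteq> V \<Longrightarrow> N = {\<one>} \<or> N = V"
    using assms(1) unfolding minimal_normal_def by blast+
  show "v \<in> carrier G" "w \<in> carrier G"
    using V assms normal_in_carrier by blast+
  fix N assume N: "N \<lhd> G"
  then have "N \<inter> V = {\<one>} \<or> N \<inter> V = V"
    using min normal_subgroup_intersect[OF N V] by blast
  then show "v \<in> N \<longleftrightarrow> w \<in> N"
    using assms by blast
qed

text \<open>A suitable power \<open>u\<close> of a nontrivial element has prime order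
  \<open>p\<close>, and every nontrivial element of \<open>V\<close> is conjugate to
  \<open>u\<close> up to inversion.\<close>

lemma (in finite_magnus_group) minimal_normal_exponent:
  assumes "minimal_normal G V"
  shows "\<exists>p::nat. prime p \<and> (\<forall>v\<in>V. v [^] p = \<one>)"
proof -
  have V: "V \<lhd> G" "V \<noteq> {\<one>}"
    using assms unfolding minimal_normal_def by blast+
  then obtain v where v: "v \<in> V" "v \<noteq> \<one>"
    using normal_one by blast
  have vG: "v \<in> carrier G" using v V normal_in_carrier by blast
  then obtain p where p: "prime p" "p dvd ord v"
    using v ord_eq_1 by (metis prime_factor_nat)
  define u where "u = v [^] (ord v div p)"
  have "ord v > 0"
    using vG finite_carrier ord_ge_1 by fastforce
  then have "ord v div p < ord v" "ord v div p > 0"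
    using p prime_gt_1_nat by (auto simp: dvd_div_eq_0_iff)
  then have u: "u \<in> V" "u \<noteq> \<one>"
    using v V vG normal_pow unfolding u_def by (auto simp: pow_eq_id dest: dvd_imp_le)
  have uG: "u \<in> carrier G" using u V normal_in_carrier by blast
  have up: "u [^] p = \<one>"
    using vG p by (simp add: u_def nat_pow_pow)
  have "w [^] p = \<one>" if w: "w \<in> V" for w
  proof (cases "w = \<one>")
    case False
    have wG: "w \<in> carrier G" using w V normal_in_carrier by blast
    obtain g where g: "g \<in> carrier G" "w = conj_by g u \<or> inv w = conj_by g u"
      using minimal_normal_conj[OF assms u w False] by blast
    then have "w [^] p = \<one> \<or> inv w [^] p = \<one>"
      using conj_pow[OF g(1) uG, of p] up g(1) by auto
    then show ?thesis
      using wG by (metis inv_eq_1_iff nat_pow_closed nat_pow_inv)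
  qed simp
  with p show ?thesis by blast
qed

text \<open>By its prime exponent \<open>V\<close> is a \<open>p\<close>-group, so its action on
  itself by conjugation has a nontrivial fixed point. The centre \<open>Z\<close> of
  \<open>V\<close> is thus nontrivial; it is normal in \<open>G\<close>, hence equal to
  \<open>V\<close>.\<close>

lemma (in finite_magnus_group) minimal_normal_comm:
  assumes "minimal_normal G V" "v \<in> V" "w \<in> V"
  shows "v \<otimes> w = w \<otimes> v"
proof -
  have V: "V \<lhd> G" "V \<noteq> {\<one>}" and min: "\<And>N. N \<lhd> G \<Longrightarrow> N \<subseteq> V \<Longrightarrow> N = {\<one>} \<or> N = V"
    using assms unfolding minimal_normal_def by blast+
  have VG: "V \<subseteq> carrier G" using V normal_in_carrier by blast
  have fin: "finite V" using VG finite_carrier finite_subset by blast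
  obtain p :: nat where p: "prime p" "\<And>v. v \<in> V \<Longrightarrow> v [^] p = \<one>"
    using minimal_normal_exponent[OF assms(1)] by blast
  obtain a where a: "card V = p ^ a"
    using card_subgroup_prime_power[OF normal_imp_subgroup[OF V(1)] fin p(1)] p(2)
    by (metis power_one_right)
  have "a \<noteq> 0"
  proof
    assume "a = 0"
    then have "card V = 1" using a by simp
    then show False
      using V normal_one by (metis card_1_singletonE singletonD)
  qed
  interpret V: group "G\<lparr>carrier := V\<rparr>"
    by (rule subgroup_imp_group) (rule normal_imp_subgroup[OF V(1)])
  have "\<exists>x\<in>V. x \<noteq> \<one> \<and> (\<forall>g\<in>carrier (G\<lparr>carrier := V\<rparr>). conj_by g x = x)"
  proof (rule p_group_nontrivial_fixed_point[of _ p a])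
    show "group (G\<lparr>carrier := V\<rparr>)" by unfold_locales
    show "order (G\<lparr>carrier := V\<rparr>) = p ^ a" using a by (simp add: order_def)
    show "p dvd card V" using a \<open>a \<noteq> 0\<close> by simp
    show "conj_by g x \<in> V" if "g \<in> carrier (G\<lparr>carrier := V\<rparr>)" "x \<in> V" for g x
      using that V VG normal_conj by auto
  qed (use V VG fin p(1) normal_one in \<open>auto simp: subset_iff conj_comp\<close>)
  then obtain z where z: "z \<in> V" "z \<noteq> \<one>" "\<And>g. g \<in> V \<Longrightarrow> conj_by g z = z"
    by auto
  define Z where "Z = {z \<in> V. \<forall>g\<in>V. conj_by g z = z}"
  have ZV: "Z \<subseteq> V" unfolding Z_def by blast
  have "Z \<lhd> G"
  proof (rule normalI')
    show "conj_by g x \<in> Z" if g: "g \<in> carrier G" and x: "x \<in> Z" for g x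
    proof -
      have "conj_by h (conj_by g x) = conj_by g x" if h: "h \<in> V" for h
      proof -
        have k: "conj_by (inv g) h \<in> V" using h g V normal_conj by simp
        have "conj_by h (conj_by g x) = conj_by g (conj_by (conj_by (inv g) h) x)"
          using g x h ZV VG by (simp add: conj_conj[of g "conj_by (inv g) h" x] conj_inv_cancel subset_iff)
        then show ?thesis using k x Z_def by simp
      qed
      then show ?thesis using V x g normal_conj unfolding Z_def by auto
    qed
  qed (use V VG in \<open>auto simp: Z_def subset_iff conj_mult conj_inv normal_one normal_mult normal_inv\<close>)
  then have "Z = V" using min z ZV unfolding Z_def by blast
  then have "conj_by v w = w" using assms(2,3) unfolding Z_def by blast
  then show ?thesis using assms(2,3) VG by (simp add: conj_fix_iff subset_iff)
qed

section \<open>Abelian normal subgroups acting on a minimal normal subgroup\<close>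

lemma (in comm_monoid) finprod_swap:
  assumes "finite I" "finite J" "\<And>i j. i \<in> I \<Longrightarrow> j \<in> J \<Longrightarrow> f i j \<in> carrier G"
  shows "(\<Otimes>i\<in>I. \<Otimes>j\<in>J. f i j) = (\<Otimes>j\<in>J. \<Otimes>i\<in>I. f i j)"
  using assms(1,3)
proof (induction rule: finite_induct)
  case (insert i I)
  have "(\<Otimes>i\<in>insert i I. \<Otimes>j\<in>J. f i j) = (\<Otimes>j\<in>J. f i j) \<otimes> (\<Otimes>j\<in>J. \<Otimes>i\<in>I. f i j)"
    using insert by (subst finprod_insert) (auto intro!: finprod_closed)
  also have "\<dots> = (\<Otimes>j\<in>J. f i j \<otimes> (\<Otimes>i\<in>I. f i j))"
    using insert.prems by (subst finprod_multf) (auto intro!: finprod_closed)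
  also have "\<dots> = (\<Otimes>j\<in>J. \<Otimes>i\<in>insert i I. f i j)"
    using insert by (intro finprod_cong') (auto intro!: finprod_closed)
  finally show ?case .
qed simp

text \<open>Commutation is asked of the automorphisms induced on \<open>V\<close>, because
  \<open>A\<close> will be the full preimage of an abelian normal subgroup of the quotient of
  \<open>G\<close> by the centralizer of \<open>V\<close>.\<close>

locale abelian_action_on_minimal_normal = finite_magnus_group +
  fixes V A
  assumes minimal: "minimal_normal G V"
    and A_normal: "A \<lhd> G"
    and commute: "\<lbrakk>a \<in> A; b \<in> A; v \<in> V\<rbrakk> \<Longrightarrow> conj_by a (conj_by b v) = conj_by b (conj_by a v)"
begin

lemma V_normal: "V \<lhd> G"
  using minimal unfolding minimal_normal_def by blast

lemma V_carrier [simp]: "v \<in> V \<Longrightarrow> v \<in> carrier G"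
  using V_normal normal_in_carrier by blast

lemma A_carrier [simp]: "a \<in> A \<Longrightarrow> a \<in> carrier G"
  using A_normal normal_in_carrier by blast

lemma conj_V: "g \<in> carrier G \<Longrightarrow> v \<in> V \<Longrightarrow> conj_by g v \<in> V"
  using V_normal normal_conj by blast

section \<open>Stabilizers in \<open>A\<close> of elements of \<open>V\<close>\<close>

abbreviation "stab v \<equiv> {a \<in> A. conj_by a v = v}"

lemma card_stab_conj:
  assumes "g \<in> carrier G" "v \<in> V"
  shows "card (stab v) \<le> card (stab (conj_by g v))"
proof (rule card_inj_on_le[of "conj_by g"])
  show "inj_on (conj_by g) (stab v)"
    using assms by (intro inj_on_inverseI[of _ "conj_by (inv g)"]) (simp add: conj_inv_cancel)
  show "conj_by g ` stab v \<subseteq> stab (conj_by g v)"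
    using assms A_normal normal_conj by (auto simp flip: conj_conj)
  show "finite (stab (conj_by g v))"
    using finite_carrier by (rule finite_subset[rotated]) auto
qed

text \<open>Inversion does not change a stabilizer, and conjugation maps one stabilizer injectively
  into another. Transitivity up to inversion then bounds each size by every other one, so all are
  equal.\<close>

lemma card_stab_le:
  assumes "v \<in> V" "v \<noteq> \<one>" "w \<in> V" "w \<noteq> \<one>"
  shows "card (stab v) \<le> card (stab w)"
proof -
  obtain g where g: "g \<in> carrier G" "w = conj_by g v \<or> inv w = conj_by g v"
    using minimal_normal_conj[OF minimal assms] by blast
  have "stab w = stab (inv w)"
    using assms(3) by (force simp: conj_inv)
  have "stab (conj_by g v) = stab w"
    using g(2)
  proof
    assume "inv w = conj_by g v"
    then show ?thesis
      unfolding \<open>stab w = stab (inv w)\<close> by simp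
  qed simp
  then show ?thesis
    using card_stab_conj[OF g(1) assms(1)] by simp
qed

lemma stab_eqI:
  assumes "v \<in> V" "v \<noteq> \<one>" "w \<in> V" "w \<noteq> \<one>" "stab v \<subseteq> stab w"
  shows "stab v = stab w"
proof (rule card_subset_eq)
  show "finite (stab w)"
    using finite_carrier by (rule finite_subset[rotated]) auto
qed (use assms card_stab_le in \<open>auto intro: antisym\<close>)

text \<open>All stabilizers in \<open>A\<close> have the same size, so \<open>V\<close> is partitioned by the fixed spaces. If \<open>b\<close>
  fixes \<open>v \<otimes> w\<close> then the displacements of \<open>v\<close> and of \<open>w\<close> are inverse to each other and lie in both
  fixed spaces.\<close>

lemma stab_eq:
  assumes v: "v \<in> V" "v \<noteq> \<one>" and w: "w \<in> V" "w \<noteq> \<one>"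
  shows "stab v = stab w"
proof (cases "v \<otimes> w = \<one>")
  case True
  then have "w = inv v"
    using v(1) w(1) by (metis V_carrier inv_comm inv_equality)
  then show ?thesis
    using v by (auto simp: conj_inv)
next
  case False
  define u where "u = v \<otimes> w"
  have u: "u \<in> V" "u \<noteq> \<one>"
    using v w False V_normal normal_mult unfolding u_def by blast+
  define t where "t b = inv v \<otimes> conj_by b v" for b
  have t_V: "t b \<in> V" if "b \<in> A" for b
    using that v V_normal normal_mult normal_inv conj_V unfolding t_def by simp
  have t_w: "t b = w \<otimes> inv (conj_by b w)" if b: "b \<in> stab u" for b
  proof -
    have "conj_by b v \<otimes> conj_by b w = v \<otimes> w"
      using b v w by (auto simp: u_def conj_mult)
    moreover have "conj_by b v = conj_by b v \<otimes> conj_by b w \<otimes> inv (conj_by b w)"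
      using b v(1) w(1) by (simp add: m_assoc)
    ultimately have "conj_by b v = v \<otimes> w \<otimes> inv (conj_by b w)"
      by simp
    then show ?thesis
      using b v w by (simp add: t_def m_assoc cancel_inv)
  qed
  show ?thesis
  proof (cases "\<exists>b\<in>stab u. t b \<noteq> \<one>")
    case True
    then obtain b where b: "b \<in> stab u" "t b \<noteq> \<one>" by blast
    then have bA: "b \<in> A" by simp
    have "stab v \<subseteq> stab (t b)"
      using bA v by (auto simp: t_def conj_mult conj_inv commute[of _ b v])
    then have "stab v = stab (t b)"
      using stab_eqI v t_V[OF bA] b(2) by blast
    moreover have "stab w \<subseteq> stab (t b)"
      using bA w unfolding t_w[OF b(1)] by (auto simp: conj_mult conj_inv commute[of _ b w])
    then have "stab w = stab (t b)"
      using stab_eqI w t_V[OF bA] b(2) by blast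
    ultimately show ?thesis by simp
  next
    case False
    \<comment> \<open>When all displacements are trivial, whatever fixes \<open>u\<close> fixes both
      \<open>v\<close> and \<open>w\<close>, so both stabilizers equal that of
      \<open>u\<close>.\<close>
    have "b \<in> stab v \<and> b \<in> stab w" if b: "b \<in> stab u" for b
    proof -
      have bA: "b \<in> A" and t1: "inv v \<otimes> conj_by b v = \<one>" "w \<otimes> inv (conj_by b w) = \<one>"
        using b False t_w[OF b] by (auto simp: t_def)
      have "conj_by b v = v \<otimes> (inv v \<otimes> conj_by b v)"
        using bA v(1) by (simp add: cancel_inv)
      moreover have "conj_by b w = inv (w \<otimes> inv (conj_by b w)) \<otimes> w"
        using bA w(1) by (simp add: inv_mult_group m_assoc)
      ultimately have "conj_by b v = v" "conj_by b w = w"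
        unfolding t1 using v(1) w(1) by simp_all
      then show ?thesis using bA by simp
    qed
    then have "stab u \<subseteq> stab v" "stab u \<subseteq> stab w" by blast+
    then have "stab u = stab v" "stab u = stab w"
      using stab_eqI[OF u v] stab_eqI[OF u w] by blast+
    then show ?thesis by simp
  qed
qed

text \<open>All nontrivial elements have the same stabilizer, so the group that \<open>A\<close>
  induces on \<open>V\<close> acts freely on them.\<close>

lemma free:
  assumes "a \<in> A" "v \<in> V" "v \<noteq> \<one>" "conj_by a v = v" "w \<in> V"
  shows "conj_by a w = w"
proof (cases "w = \<one>")
  case False
  have "a \<in> stab v" using assms by simp
  then have "a \<in> stab w"
    using stab_eq[OF assms(2,3,5) False] by blast
  then show ?thesis by simp
qed (use assms in simp)

section \<open>Norms under cyclic groups of automorphisms\<close>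

abbreviation "VG \<equiv> G\<lparr>carrier := V\<rparr>"

lemma V_comm_group: "comm_group VG"
proof (rule group.group_comm_groupI)
  show "group VG"
    by (rule subgroup_imp_group) (rule normal_imp_subgroup[OF V_normal])
qed (use minimal_normal_comm[OF minimal] in simp)

lemma conj_finprod:
  assumes "g \<in> carrier G" "\<And>i. i \<in> S \<Longrightarrow> f i \<in> V"
  shows "conj_by g (finprod VG f S) = finprod VG (\<lambda>i. conj_by g (f i)) S"
proof -
  interpret V: comm_group VG by (rule V_comm_group)
  show ?thesis
  proof (cases "finite S")
    case True
    then show ?thesis
      using assms(2)
    proof (induction rule: finite_induct)
      case (insert i S)
      have "finprod VG f S \<in> V"
        using V.finprod_closed[of f S] insert by auto
      then show ?case
        using insert assms(1) V.finprod_insert[of S i f] V.finprod_insert[of S i "\<lambda>i. conj_by g (f i)"]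
        by (simp add: Pi_def conj_V conj_mult)
    qed (simp add: assms(1))
  qed (simp add: assms(1))
qed

lemma conj_pow_mod:
  assumes "e \<in> carrier G" "\<And>v. v \<in> V \<Longrightarrow> conj_by (e [^] (r::nat)) v = v" "v \<in> V"
  shows "conj_by (e [^] (n mod r)) v = conj_by (e [^] n) v"
proof -
  have "conj_by (e [^] n) v = conj_by (e [^] (n mod r) \<otimes> (e [^] r) [^] (n div r)) v"
    using assms(1) by (simp add: nat_pow_pow nat_pow_mult)
  then show ?thesis
    using assms by (simp add: conj_comp conj_fix_pow)
qed

text \<open>The norm of \<open>v\<close> for the cyclic group induced by \<open>e\<close> on
  \<open>V\<close>, used when \<open>e [^] r\<close> acts trivially. The product runs over
  exponents, so translates of \<open>v\<close> count with multiplicity.\<close>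

definition norm_by :: "nat \<Rightarrow> 'a \<Rightarrow> 'a \<Rightarrow> 'a"
  where "norm_by r e v = finprod VG (\<lambda>k. conj_by (e [^] k) v) {..<r}"

text \<open>For \<open>s\<close> prime to \<open>r\<close>, sending \<open>k\<close> to
  \<open>s * k + c\<close> permutes the residues modulo \<open>r\<close>, and the powers of
  \<open>e\<close> act on \<open>V\<close> only through the residues of their exponents.\<close>

lemma norm_by_reindex:
  assumes "e \<in> carrier G" "\<And>v. v \<in> V \<Longrightarrow> conj_by (e [^] r) v = v" "v \<in> V"
    and "coprime s r"
  shows "finprod VG (\<lambda>k. conj_by (e [^] (s * k + c)) v) {..<r} = norm_by r e v"
proof -
  interpret V: comm_group VG by (rule V_comm_group)
  define h where "h k = (s * k + c) mod r" for k
  have inj: "inj_on h {..<r}"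
  proof (rule inj_onI)
    fix x y assume "x \<in> {..<r}" "y \<in> {..<r}" "h x = h y"
    then have "[s * x + c = s * y + c] (mod r)" "x < r" "y < r"
      by (auto simp: h_def cong_def)
    then have "[x = y] (mod r)"
      using assms(4) by (simp add: cong_add_rcancel_nat cong_mult_lcancel_nat)
    then show "x = y"
      using \<open>x < r\<close> \<open>y < r\<close> by (simp add: cong_def)
  qed
  have "h ` {..<r} \<subseteq> {..<r}"
    by (auto simp: h_def)
  then have img: "h ` {..<r} = {..<r}"
    using inj by (simp add: endo_inj_surj)
  have "norm_by r e v = finprod VG (\<lambda>k. conj_by (e [^] k) v) (h ` {..<r})"
    unfolding norm_by_def img ..
  also have "\<dots> = finprod VG (\<lambda>k. conj_by (e [^] h k) v) {..<r}"
    using inj assms by (intro V.finprod_reindex) (auto intro!: conj_V)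
  also have "\<dots> = finprod VG (\<lambda>k. conj_by (e [^] (s * k + c)) v) {..<r}"
    unfolding h_def using assms by (simp add: conj_pow_mod)
  finally show ?thesis ..
qed

lemma norm_by_closed:
  assumes "e \<in> carrier G" "v \<in> V"
  shows "norm_by r e v \<in> V"
proof -
  interpret V: comm_group VG by (rule V_comm_group)
  have "norm_by r e v \<in> carrier VG"
    unfolding norm_by_def using assms by (intro V.finprod_closed) (auto intro!: conj_V)
  then show ?thesis by simp
qed

text \<open>The norm is fixed by \<open>e\<close>. Were it nontrivial, freeness would make
  \<open>e\<close> fix all of \<open>V\<close>.\<close>

lemma norm_by_trivial:
  assumes e: "e \<in> A" "\<And>v. v \<in> V \<Longrightarrow> conj_by (e [^] r) v = v"
    and nontrivial: "\<exists>w\<in>V. conj_by e w \<noteq> w" and v: "v \<in> V"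
  shows "norm_by r e v = \<one>"
proof (rule ccontr)
  assume ne: "norm_by r e v \<noteq> \<one>"
  have eG: "e \<in> carrier G" using e by simp
  have "conj_by e (norm_by r e v) = finprod VG (\<lambda>k. conj_by e (conj_by (e [^] k) v)) {..<r}"
    unfolding norm_by_def using eG v by (intro conj_finprod) (auto intro!: conj_V)
  \<comment> \<open>The exponent is spelled \<open>1 * k + 1\<close> to match the reindexing with
    \<open>s = 1\<close> and \<open>c = 1\<close>.\<close>
  also have "\<dots> = finprod VG (\<lambda>k. conj_by (e [^] (1 * k + 1)) v) {..<r}"
  proof -
    have "conj_by e (conj_by (e [^] k) v) = conj_by (e [^] (1 * k + 1)) v" for k :: nat
      using eG v nat_pow_Suc2[OF eG, of k] by (metis V_carrier Suc_eq_plus1 conj_comp mult_1 nat_pow_closed)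
    then show ?thesis by simp
  qed
  also have "\<dots> = norm_by r e v"
    using eG e(2) v by (intro norm_by_reindex) auto
  finally have fixed: "conj_by e (norm_by r e v) = norm_by r e v" .
  show False
    using free[OF e(1) norm_by_closed[OF eG v] ne fixed] nontrivial by blast
qed

text \<open>With \<open>m\<close> the part of \<open>ord a\<close> prime to \<open>p\<close>, the
  power \<open>a [^] m\<close> generates a \<open>p\<close>-group acting on the
  \<open>p\<close>-group \<open>V\<close>. It fixes a nontrivial element, so by freeness it acts
  trivially, and Bezout's identity for \<open>m\<close> and \<open>p\<close> gives the same for
  \<open>a\<close>.\<close>

lemma p_element_trivial:
  assumes p: "prime (p::nat)" "\<And>v. v \<in> V \<Longrightarrow> v [^] p = \<one>"
    and a: "a \<in> A" "\<And>v. v \<in> V \<Longrightarrow> conj_by (a [^] p) v = v" and v: "v \<in> V"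
  shows "conj_by a v = v"
proof -
  have aG: "a \<in> carrier G" using a by simp
  have "ord a \<noteq> 0" "\<not> is_unit p"
    using ord_ge_1[OF finite_carrier aG] p(1) by auto
  then obtain m where m: "ord a = p ^ multiplicity p (ord a) * m" "\<not> p dvd m"
    using multiplicity_decompose' by blast
  define k where "k = multiplicity p (ord a)"
  define b where "b = a [^] m"
  have bA: "b \<in> A" and bG: "b \<in> carrier G"
    using a(1) A_normal normal_pow unfolding b_def by auto
  have "m \<noteq> 0" using m(2) by (metis dvd_0_right)
  then have "ord b = p ^ k"
    unfolding b_def k_def using ord_pow[OF aG, of m] m(1)
    by (metis dvd_triv_right nonzero_mult_div_cancel_right)
  have VC: "V \<subseteq> carrier G" by auto
  have fin: "finite V" using VC finite_carrier finite_subset by blast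
  obtain l where l: "card V = p ^ l"
    using card_subgroup_prime_power[OF normal_imp_subgroup[OF V_normal] fin p(1)] p(2)
    by (metis power_one_right)
  have "V \<noteq> {\<one>}" using minimal unfolding minimal_normal_def by blast
  then have "l \<noteq> 0"
    using l normal_one[OF V_normal] by (metis card_1_singletonE power_0 singletonD)
  have "\<exists>x\<in>V. x \<noteq> \<one> \<and> (\<forall>g\<in>carrier (G\<lparr>carrier := generate G {b}\<rparr>). conj_by g x = x)"
  proof (rule p_group_nontrivial_fixed_point[of _ p k])
    have sub: "subgroup (generate G {b}) G" using generate_is_subgroup bG by simp
    show "group (G\<lparr>carrier := generate G {b}\<rparr>)" using sub by (rule subgroup_imp_group)
    show "order (G\<lparr>carrier := generate G {b}\<rparr>) = p ^ k"
      using generate_pow_card[OF bG] \<open>ord b = p ^ k\<close> by (simp add: order_def)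
    have gG: "g \<in> carrier G" if "g \<in> carrier (G\<lparr>carrier := generate G {b}\<rparr>)" for g
      using that sub subgroup.mem_carrier by fastforce
    show "p dvd card V" using l \<open>l \<noteq> 0\<close> by simp
    show "conj_by g x \<in> V" if "g \<in> carrier (G\<lparr>carrier := generate G {b}\<rparr>)" "x \<in> V" for g x
      using that gG conj_V by blast
    show "conj_by (g \<otimes>\<^bsub>G\<lparr>carrier := generate G {b}\<rparr>\<^esub> h) x = conj_by g (conj_by h x)"
      if "g \<in> carrier (G\<lparr>carrier := generate G {b}\<rparr>)" "h \<in> carrier (G\<lparr>carrier := generate G {b}\<rparr>)"
         "x \<in> V" for g h x
      using gG[OF that(1)] gG[OF that(2)] that(3) by (simp add: conj_comp)
    show "conj_by g \<one> = \<one>" if "g \<in> carrier (G\<lparr>carrier := generate G {b}\<rparr>)" for g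
      using gG[OF that] by simp
  qed (use fin p(1) normal_one[OF V_normal] in auto)
  then obtain x where x: "x \<in> V" "x \<noteq> \<one>" "conj_by b x = x"
    using generate.incl[of b "{b}"] by auto
  have "conj_by (a [^] m) v = v"
    using free[OF bA x(1,2,3) v] unfolding b_def .
  moreover have "coprime m p"
    using prime_imp_coprime[OF p(1) m(2)] by (rule coprime_commute[THEN iffD1])
  then obtain i j where "m * i = p * j + 1"
    using bezout_nat[of m p] \<open>m \<noteq> 0\<close> by (metis coprime_imp_gcd_eq_1)
  then have "a [^] (m * i) = (a [^] p) [^] j \<otimes> a"
    using aG by (simp add: nat_pow_pow)
  then have "conj_by ((a [^] m) [^] i) v = conj_by ((a [^] p) [^] j) (conj_by a v)"
    using aG v by (simp add: nat_pow_pow conj_comp)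
  ultimately show ?thesis
    using aG v a(2) conj_V[OF aG v] by (simp add: conj_fix_pow)
qed

text \<open>If the conclusion fails, the norm of \<open>v\<close> under each \<open>b \<otimes> a [^] s\<close> and under \<open>a\<close> is a fixed point,
  hence trivial. The product of the former over all \<open>s < r\<close> equals \<open>v [^] r\<close> times conjugates of the
  latter, so \<open>V\<close> has exponent \<open>r\<close>; but then \<open>a\<close>, an \<open>r\<close>-element modulo the centralizer, has a fixed point.\<close>

lemma prime_order_cyclic:
  assumes r: "prime (r::nat)"
    and a: "a \<in> A" "\<And>v. v \<in> V \<Longrightarrow> conj_by (a [^] r) v = v" "\<exists>v\<in>V. conj_by a v \<noteq> v"
    and b: "b \<in> A" "\<And>v. v \<in> V \<Longrightarrow> conj_by (b [^] r) v = v"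
  shows "\<exists>k::nat. \<forall>v\<in>V. conj_by b v = conj_by (a [^] k) v"
proof (rule ccontr)
  assume none: "\<not> ?thesis"
  interpret V: comm_group VG by (rule V_comm_group)
  have aG: "a \<in> carrier G" and bG: "b \<in> carrier G" using a b by simp_all
  have "r > 0" using r prime_gt_0_nat by blast
  have "v [^] r = \<one>" if v: "v \<in> V" for v
  proof -
    \<comment> \<open>Only the actions of \<open>a\<close> and \<open>b\<close> on \<open>V\<close>
      are known to commute, so the power of the product is expanded on \<open>V\<close> and not in
      \<open>G\<close>.\<close>
    have pow: "conj_by ((b \<otimes> a [^] s) [^] n) w = conj_by (b [^] n) (conj_by (a [^] (s * n)) w)"
      if w: "w \<in> V" for s n :: nat and w
      using w
    proof (induction n arbitrary: w)
      case (Suc n)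
      let ?u = "conj_by (a [^] s) w"
      have uV: "?u \<in> V" using Suc.prems aG by (simp add: conj_V)
      have "conj_by ((b \<otimes> a [^] s) [^] Suc n) w
        = conj_by ((b \<otimes> a [^] s) [^] n) (conj_by b ?u)"
        using Suc.prems aG bG by (simp add: conj_comp)
      also have "\<dots> = conj_by (b [^] n) (conj_by (a [^] (s * n)) (conj_by b ?u))"
        using Suc.IH[OF conj_V[OF bG uV]] .
      also have "\<dots> = conj_by (b [^] n) (conj_by b (conj_by (a [^] (s * n)) ?u))"
        using uV a(1) b(1) normal_pow[OF A_normal] by (simp add: commute)
      also have "\<dots> = conj_by (b [^] Suc n) (conj_by (a [^] (s * Suc n)) w)"
      proof -
        have "a [^] (s * Suc n) = a [^] (s * n) \<otimes> a [^] s"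
          using aG by (simp add: nat_pow_mult add.commute)
        then show ?thesis
          using Suc.prems aG bG by (simp add: conj_comp)
      qed
      finally show ?case .
    qed (use aG bG in simp)
    have triv: "norm_by r (b \<otimes> a [^] s) v = \<one>" if s: "s < r" for s
    proof (rule norm_by_trivial)
      show "b \<otimes> a [^] s \<in> A"
        using a(1) b(1) A_normal normal_mult normal_pow by blast
      show "conj_by ((b \<otimes> a [^] s) [^] r) w = w" if "w \<in> V" for w
      proof -
        have "a [^] (s * r) = (a [^] r) [^] s"
          using aG by (simp add: nat_pow_pow mult.commute)
        then show ?thesis
          using that aG a(2) b(2) by (simp add: pow conj_fix_pow)
      qed
      show "\<exists>w\<in>V. conj_by (b \<otimes> a [^] s) w \<noteq> w"
      proof (rule ccontr)
        \<comment> \<open>If \<open>b \<otimes> a [^] s\<close> acted trivially, \<open>b\<close>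
          would act as the inverse of \<open>a [^] s\<close>, which on \<open>V\<close> is
          \<open>a [^] (r - s)\<close>, contrary to \<open>none\<close>.\<close>
        assume "\<not> ?thesis"
        then have e1: "conj_by (b \<otimes> a [^] s) w = w" if "w \<in> V" for w
          using that by blast
        have "conj_by b w = conj_by (a [^] (r - s)) w" if w: "w \<in> V" for w
        proof -
          define u where "u = conj_by (a [^] (r - s)) w"
          have uV: "u \<in> V" using w aG unfolding u_def by (simp add: conj_V)
          have "conj_by (a [^] s) u = conj_by (a [^] r) w"
            using s w aG unfolding u_def by (simp add: nat_pow_mult flip: conj_comp)
          then have "conj_by b w = conj_by (b \<otimes> a [^] s) u"
            using w uV aG bG a(2) by (simp add: conj_comp)
          then show ?thesis using e1[OF uV] u_def by simp
        qed
        then show False using none by blast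
      qed
    qed (rule v)
    define F where "F s k = conj_by (b [^] k) (conj_by (a [^] (s * k)) v)" for s k :: nat
    have F_V: "F s k \<in> carrier VG" for s k
      using v aG bG unfolding F_def by (simp add: conj_V)
    have cl: "finprod VG (\<lambda>s. F s k) {..<r} \<in> carrier VG" for k
      using F_V by (intro V.finprod_closed) auto
    have "\<one>\<^bsub>VG\<^esub> = finprod VG (\<lambda>s. norm_by r (b \<otimes> a [^] s) v) {..<r}"
      by (rule sym, rule V.finprod_one_eqI) (simp add: triv)
    also have "\<dots> = finprod VG (\<lambda>s. finprod VG (\<lambda>k. F s k) {..<r}) {..<r}"
      unfolding norm_by_def F_def using v by (simp add: pow)
    also have "\<dots> = finprod VG (\<lambda>k. finprod VG (\<lambda>s. F s k) {..<r}) {..<r}"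
      using F_V by (intro V.finprod_swap) auto
    \<comment> \<open>The index \<open>k = 0\<close> is split off; there every factor is
      \<open>v\<close>. Every other \<open>k\<close> is prime to \<open>r\<close>, so
      \<open>s * k\<close> runs through all residues and the product over \<open>s\<close> is a
      conjugate of the norm of \<open>v\<close> under \<open>a\<close>.\<close>
    also have "\<dots> = finprod VG (\<lambda>k. finprod VG (\<lambda>s. F s k) {..<r}) (insert 0 {1..<r})"
      using \<open>r > 0\<close> by (intro arg_cong[of _ _ "finprod VG _"]) auto
    also have "\<dots> = finprod VG (\<lambda>s. F s 0) {..<r} \<otimes> finprod VG (\<lambda>k. finprod VG (\<lambda>s. F s k) {..<r}) {1..<r}"
      using cl V.finprod_insert[of "{1..<r}" 0 "\<lambda>k. finprod VG (\<lambda>s. F s k) {..<r}"]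
      by (simp add: Pi_def)
    also have "finprod VG (\<lambda>k. finprod VG (\<lambda>s. F s k) {..<r}) {1..<r} = \<one>\<^bsub>VG\<^esub>"
    proof (rule V.finprod_one_eqI)
      fix k assume k: "k \<in> {1..<r}"
      have "finprod VG (\<lambda>s. F s k) {..<r}
        = conj_by (b [^] k) (finprod VG (\<lambda>s. conj_by (a [^] (k * s + 0)) v) {..<r})"
        unfolding F_def using v aG bG by (subst conj_finprod) (auto intro!: conj_V simp: mult.commute)
      also have "finprod VG (\<lambda>s. conj_by (a [^] (k * s + 0)) v) {..<r} = norm_by r a v"
      proof (rule norm_by_reindex)
        show "coprime k r"
          using k r by (metis atLeastLessThan_iff coprime_commute less_le_not_le nat_dvd_not_less
              prime_imp_coprime zero_less_one order_less_le_trans)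
      qed (use aG a(2) v in auto)
      also have "norm_by r a v = \<one>"
        using a v by (intro norm_by_trivial) auto
      finally show "finprod VG (\<lambda>s. F s k) {..<r} = \<one>\<^bsub>VG\<^esub>"
        using bG by simp
    qed
    also have "finprod VG (\<lambda>s. F s 0) {..<r} = v [^]\<^bsub>VG\<^esub> r"
      using V.finprod_const[of v "{..<r}"] v by (simp add: F_def)
    finally show ?thesis
      using v by (simp flip: nat_pow_consistent)
  qed
  then show False
    using p_element_trivial[OF r _ a(1,2)] a(3) by blast
qed

end

section \<open>Chief factors\<close>

declare mult_FactGroup [simp del] one_FactGroup [simp del]

lemma (in group_hom) hom_conj:
  "g \<in> carrier G \<Longrightarrow> x \<in> carrier G \<Longrightarrow> h (G.conj_by g x) = H.conj_by (h g) (h x)"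
  by (simp add: G.conj_by_def H.conj_by_def)

text \<open>By the correspondence theorem, normal subgroups inside the image of \<open>U\<close>
  pull back to normal subgroups between the kernel and \<open>U\<close>, where \<open>chief\<close>
  leaves only the two ends.\<close>

lemma (in group_hom) minimal_normal_image:
  assumes surj: "h ` carrier G = carrier H"
    and U: "U \<lhd> G" "kernel G H h \<subseteq> U" "U \<noteq> kernel G H h"
    and chief: "\<And>N. N \<lhd> G \<Longrightarrow> kernel G H h \<subseteq> N \<Longrightarrow> N \<subseteq> U \<Longrightarrow> N = kernel G H h \<or> N = U"
  shows "minimal_normal H (h ` U)"
  unfolding minimal_normal_def
proof (intro conjI allI impI)
  have UG: "U \<subseteq> carrier G" using U(1) G.normal_in_carrier by blast
  show "h ` U \<lhd> H"
    using surj_img_normal[OF U(1) surj] .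
  show "h ` U \<noteq> {\<one>\<^bsub>H\<^esub>}"
  proof
    assume "h ` U = {\<one>\<^bsub>H\<^esub>}"
    then have "U \<subseteq> kernel G H h"
      using UG by (auto simp: kernel_def)
    then show False using U by blast
  qed
  fix N assume N: "N \<lhd> H" "N \<subseteq> h ` U"
  define M where "M = {x \<in> carrier G. h x \<in> N}"
  have "M \<lhd> G" using vimage_normal[OF N(1)] unfolding M_def .
  moreover have "kernel G H h \<subseteq> M"
    using H.normal_one[OF N(1)] by (auto simp: kernel_def M_def)
  moreover have "M \<subseteq> U"
  proof
    fix x assume x: "x \<in> M"
    then obtain u where u: "u \<in> U" "h x = h u" using N(2) unfolding M_def by blast
    have xG: "x \<in> carrier G" "u \<in> carrier G" using x u UG M_def by auto
    then have "x \<otimes> inv u \<in> kernel G H h"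
      using u(2) by (simp add: kernel_def)
    then have "x \<otimes> inv u \<otimes> u \<in> U"
      using U u(1) G.normal_mult by blast
    then show "x \<in> U" using xG by (simp add: G.m_assoc)
  qed
  ultimately have "M = kernel G H h \<or> M = U" by (rule chief)
  moreover have "h ` M = N"
    using N H.normal_in_carrier[OF N(1)] surj unfolding M_def by (auto simp: image_iff)
  moreover have "h ` kernel G H h = {\<one>\<^bsub>H\<^esub>}"
    using G.one_closed hom_one by (force simp: kernel_def)
  ultimately show "N = {\<one>\<^bsub>H\<^esub>} \<or> N = h ` U" by auto
qed

lemma (in normal) quotient_map:
  shows "group_hom G (G Mod H) (\<lambda>x. H #> x)"
    and "(\<lambda>x. H #> x) ` carrier G = carrier (G Mod H)"
    and "kernel G (G Mod H) (\<lambda>x. H #> x) = H"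
proof -
  show "group_hom G (G Mod H) (\<lambda>x. H #> x)"
    by (intro group_hom.intro group_hom_axioms.intro factorgroup_is_group r_coset_hom_Mod) unfold_locales
  show "(\<lambda>x. H #> x) ` carrier G = carrier (G Mod H)"
    by (simp add: carrier_FactGroup)
  show "kernel G (G Mod H) (\<lambda>x. H #> x) = H"
    using coset_join1[OF _ _ subgroup_axioms] coset_join2[OF _ subgroup_axioms]
    by (auto simp: kernel_def one_FactGroup)
qed

context group
begin

lemma r_coset_eq_iff:
  assumes "A \<lhd> G" "x \<in> carrier G" "y \<in> carrier G"
  shows "A #> x = A #> y \<longleftrightarrow> x \<otimes> inv y \<in> A"
proof -
  interpret A: normal A G by fact
  have "x \<in> A #> y \<longleftrightarrow> A #> x = A #> y"
    using assms(2,3) repr_independence[of x A y] rcos_self[of x A] A.subgroup_axioms by blast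
  then show ?thesis
    using A.rcos_module[OF is_group assms(3,2)] by simp
qed

lemma r_coset_eq_self_iff:
  assumes "A \<lhd> G" "x \<in> carrier G"
  shows "A #> x = A \<longleftrightarrow> x \<in> A"
  using r_coset_eq_iff[OF assms one_closed] assms normal_in_carrier[OF assms(1)]
  by (metis coset_mult_one inv_one r_one subsetI)

text \<open>Lets \<open>G\<close> act on the cosets in \<open>U / A\<close> by taking images of
  sets, without passing through the quotient group.\<close>

lemma conj_r_coset:
  assumes "A \<lhd> G" "g \<in> carrier G" "x \<in> carrier G"
  shows "conj_by g ` (A #> x) = A #> conj_by g x"
proof
  have AG: "a \<in> carrier G" if "a \<in> A" for a using that assms(1) normal_in_carrier by blast
  show "conj_by g ` (A #> x) \<subseteq> A #> conj_by g x"
    using assms AG normal_conj[OF assms(1)] by (auto simp: r_coset_def conj_mult)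
  show "A #> conj_by g x \<subseteq> conj_by g ` (A #> x)"
  proof
    fix y assume "y \<in> A #> conj_by g x"
    then obtain a where a: "a \<in> A" "y = a \<otimes> conj_by g x" by (auto simp: r_coset_def)
    have a': "conj_by (inv g) a \<in> A" using a assms normal_conj by simp
    have "y = conj_by g (conj_by (inv g) a \<otimes> x)"
      using a AG assms by (simp add: conj_mult conj_inv_cancel)
    then show "y \<in> conj_by g ` (A #> x)"
      using a' by (auto simp: r_coset_def)
  qed
qed

definition centralizer :: "'a set \<Rightarrow> 'a set"
  where "centralizer S = {g \<in> carrier G. \<forall>x\<in>S. conj_by g x = x}"

lemma centralizer_normal:
  assumes "N \<lhd> G"
  shows "centralizer N \<lhd> G"
proof (rule normalI')
  have NG: "x \<in> carrier G" if "x \<in> N" for x using that assms normal_in_carrier by blast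
  show "\<one> \<in> centralizer N"
    using NG unfolding centralizer_def by auto
  fix c assume c: "c \<in> centralizer N"
  then show "inv c \<in> centralizer N"
    using NG unfolding centralizer_def by (auto intro: conj_fix_inv)
  show "c \<otimes> d \<in> centralizer N" if "d \<in> centralizer N" for d
    using c that NG unfolding centralizer_def by (auto simp: conj_comp)
  show "conj_by g c \<in> centralizer N" if g: "g \<in> carrier G" for g
  proof -
    have "conj_by (conj_by g c) x = x" if x: "x \<in> N" for x
    proof -
      have "conj_by c (conj_by (inv g) x) = conj_by (inv g) x"
        using c normal_conj[OF assms x, of "inv g"] g unfolding centralizer_def by auto
      moreover have "conj_by (conj_by g c) (conj_by g (conj_by (inv g) x))
        = conj_by g (conj_by c (conj_by (inv g) x))"
        using c g NG[OF x] unfolding centralizer_def by (simp add: conj_conj[of g c])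
      ultimately show ?thesis using g NG[OF x] by (simp add: conj_inv_cancel)
    qed
    then show ?thesis using c g unfolding centralizer_def by simp
  qed
qed (auto simp: centralizer_def)

end

text \<open>The pair describes a chief factor \<open>U / A\<close>. Its image in
  \<open>G Mod A\<close> is minimal normal and the quotient keeps the Magnus Property, so the
  results on minimal normal subgroups can be read back to \<open>U\<close> modulo
  \<open>A\<close>.\<close>

locale magnus_chief_section = finite_magnus_group +
  fixes A U
  assumes A_normal: "A \<lhd> G" and U_normal: "U \<lhd> G"
    and A_sub_U: "A \<subseteq> U" and A_neq_U: "A \<noteq> U"
    and chief: "\<lbrakk>N \<lhd> G; A \<subseteq> N; N \<subseteq> U\<rbrakk> \<Longrightarrow> N = A \<or> N = U"
begin

lemma A_carrier [simp]: "a \<in> A \<Longrightarrow> a \<in> carrier G"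
  using A_normal normal_in_carrier by blast

lemma U_carrier [simp]: "u \<in> U \<Longrightarrow> u \<in> carrier G"
  using U_normal normal_in_carrier by blast

abbreviation "Q \<equiv> G Mod A"

sublocale q: group_hom G Q "\<lambda>x. A #> x"
  by (rule normal.quotient_map(1)[OF A_normal])

lemma q_surj: "(\<lambda>x. A #> x) ` carrier G = carrier Q"
  by (rule normal.quotient_map(2)[OF A_normal])

lemma q_magnus: "finite_magnus_group Q"
  by (rule finite_magnus_image[OF q.group_hom_axioms q_surj])

lemma q_minimal: "minimal_normal Q ((\<lambda>x. A #> x) ` U)"
  using q.minimal_normal_image[OF q_surj U_normal] A_sub_U A_neq_U chief
  unfolding normal.quotient_map(3)[OF A_normal] by auto

lemma section_comm:
  assumes "u \<in> U" "v \<in> U"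
  shows "conj_by u v \<otimes> inv v \<in> A"
proof -
  have "(A #> u) \<otimes>\<^bsub>Q\<^esub> (A #> v) = (A #> v) \<otimes>\<^bsub>Q\<^esub> (A #> u)"
    using finite_magnus_group.minimal_normal_comm[OF q_magnus q_minimal] assms by blast
  then have "A #> (u \<otimes> v) = A #> (v \<otimes> u)"
    using assms by (simp flip: q.hom_mult)
  then have "u \<otimes> v \<otimes> inv (v \<otimes> u) \<in> A"
    using assms r_coset_eq_iff[OF A_normal, of "u \<otimes> v" "v \<otimes> u"] by simp
  then show ?thesis
    using assms by (simp add: conj_by_def inv_mult_group m_assoc)
qed

lemma section_exponent: "\<exists>r::nat. prime r \<and> (\<forall>u\<in>U. u [^] r \<in> A)"
proof -
  obtain r :: nat where r: "prime r" "\<And>v. v \<in> (\<lambda>x. A #> x) ` U \<Longrightarrow> v [^]\<^bsub>Q\<^esub> r = \<one>\<^bsub>Q\<^esub>"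
    using finite_magnus_group.minimal_normal_exponent[OF q_magnus q_minimal] by blast
  have "u [^] r \<in> A" if u: "u \<in> U" for u
  proof -
    have "A #> (u [^] r) = A"
      using r(2)[of "A #> u"] u by (simp add: one_FactGroup flip: q.hom_nat_pow)
    then show ?thesis
      using u by (simp add: r_coset_eq_self_iff[OF A_normal])
  qed
  with r(1) show ?thesis by blast
qed

lemma section_conj:
  assumes "u \<in> U" "u \<notin> A" "v \<in> U" "v \<notin> A"
  shows "\<exists>g\<in>carrier G. A #> v = A #> conj_by g u \<or> A #> v = A #> inv (conj_by g u)"
proof -
  have ne: "A #> u \<noteq> \<one>\<^bsub>Q\<^esub>" "A #> v \<noteq> \<one>\<^bsub>Q\<^esub>"
    using assms by (simp_all add: one_FactGroup r_coset_eq_self_iff[OF A_normal])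
  obtain h where h: "h \<in> carrier Q"
    "A #> v = q.H.conj_by h (A #> u) \<or> inv\<^bsub>Q\<^esub> (A #> v) = q.H.conj_by h (A #> u)"
    using finite_magnus_group.minimal_normal_conj[OF q_magnus q_minimal _ ne(1) _ ne(2)] assms by blast
  then obtain g where g: "g \<in> carrier G" "h = A #> g"
    using q_surj by blast
  have "A #> v = A #> conj_by g u \<or> A #> inv v = A #> conj_by g u"
    using h(2) g assms by (simp add: q.hom_conj)
  moreover have "A #> v = A #> inv (conj_by g u)" if "A #> inv v = A #> conj_by g u"
  proof -
    have "A #> inv (inv v) = A #> inv (conj_by g u)"
      using that assms g(1) q.hom_inv by (metis U_carrier conj_closed inv_closed)
    then show ?thesis using assms by simp
  qed
  ultimately show ?thesis using g(1) by blast
qed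

end

text \<open>The assumptions of this locale are contradictory.\<close>

locale magnus_central_section = magnus_chief_section +
  fixes r :: nat and u1 u2
  assumes r: "prime r" and exponent: "u \<in> U \<Longrightarrow> u [^] r \<in> A"
    and central: "\<lbrakk>a \<in> A; u \<in> U\<rbrakk> \<Longrightarrow> conj_by u a = a"
    and u1: "u1 \<in> U" and u2: "u2 \<in> U" and noncomm: "conj_by u1 u2 \<noteq> u2"
    and cyclic: "\<lbrakk>a \<in> A; b \<in> A; a [^] r = \<one>; b [^] r = \<one>; a \<noteq> \<one>\<rbrakk> \<Longrightarrow> \<exists>k::nat. b = a [^] k"
begin

text \<open>The commutator of \<open>u1\<close> and \<open>u2\<close>. It lies in \<open>A\<close>
  because the chief factor is abelian, and it is nontrivial by \<open>noncomm\<close>.\<close>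

definition "z = conj_by u1 u2 \<otimes> inv u2"

lemma z_A: "z \<in> A"
  unfolding z_def using section_comm u1 u2 .

lemma z_carrier [simp]: "z \<in> carrier G"
  using z_A by simp

lemma z_neq: "z \<noteq> \<one>"
proof
  assume "z = \<one>"
  then have "conj_by u1 u2 \<otimes> inv u2 \<otimes> u2 = u2"
    using u2 by (simp flip: z_def)
  then show False using u1 u2 noncomm by (simp add: m_assoc)
qed

text \<open>Conjugation by \<open>u1\<close> fixes \<open>u2 [^] r\<close>, which lies in
  \<open>A\<close>, and sends \<open>u2\<close> to \<open>z \<otimes> u2\<close>, where
  \<open>z\<close> and \<open>u2\<close> commute. Comparing \<open>r\<close>-th powers isolates
  \<open>z [^] r\<close>.\<close>

lemma z_pow: "z [^] r = \<one>"
proof -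
  have zu: "conj_by u1 u2 = z \<otimes> u2"
    unfolding z_def using u1 u2 by (simp add: m_assoc)
  have "u2 [^] r = conj_by u1 (u2 [^] r)"
    using central exponent u1 u2 by simp
  also have "\<dots> = (z \<otimes> u2) [^] r"
    using u1 u2 by (simp add: conj_pow zu)
  also have "\<dots> = z [^] r \<otimes> u2 [^] r"
  proof (rule pow_mult_distrib)
    show "z \<otimes> u2 = u2 \<otimes> z"
      using central[OF z_A u2] u2 by (simp add: conj_fix_iff)
  qed (use u2 in simp_all)
  finally show ?thesis
    using u2 right_cancel[of "u2 [^] r" "\<one>" "z [^] r"] by simp
qed

lemma ord_z: "ord z = r"
proof -
  have "ord z dvd r" using z_pow by (simp add: pow_eq_id)
  moreover have "ord z \<noteq> 1" using z_neq by (simp only: ord_eq_1[OF z_carrier] not_False_eq_True)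
  ultimately show ?thesis using r by (auto simp: prime_nat_iff)
qed

text \<open>A conjugate of \<open>z\<close> lies in \<open>A\<close> and has trivial
  \<open>r\<close>-th power, so by \<open>cyclic\<close> it is a power of \<open>z\<close>. Being
  nontrivial, it has an exponent from 1 to \<open>r - 1\<close>.\<close>

lemma card_conj_z: "finite {conj_by g z | g. g \<in> carrier G}" "card {conj_by g z | g. g \<in> carrier G} < r"
proof -
  have sub: "{conj_by g z | g. g \<in> carrier G} \<subseteq> (\<lambda>k. z [^] k) ` {1..<r}"
  proof
    fix w assume "w \<in> {conj_by g z | g. g \<in> carrier G}"
    then obtain g where g: "g \<in> carrier G" "w = conj_by g z" by blast
    have "w [^] r = \<one>"
      using g z_pow by (simp flip: conj_pow)
    moreover have "w \<in> A" using g z_A A_normal normal_conj by blast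
    ultimately obtain k :: nat where "w = z [^] k"
      using cyclic[OF z_A _ z_pow _ z_neq] by blast
    moreover have "z [^] k = (z [^] r) [^] (k div r) \<otimes> z [^] (k mod r)"
      by (simp add: nat_pow_pow nat_pow_mult)
    ultimately have k: "w = z [^] (k mod r)"
      by (simp add: z_pow)
    moreover have "w \<noteq> \<one>"
      using g z_neq by (metis conj_inv_cancel(1) conj_one(2) inv_closed z_carrier)
    ultimately have "k mod r \<noteq> 0" by (metis nat_pow_0)
    then show "w \<in> (\<lambda>k. z [^] k) ` {1..<r}"
      using k r prime_gt_0_nat by auto
  qed
  then show "finite {conj_by g z | g. g \<in> carrier G}"
    using finite_subset by blast
  show "card {conj_by g z | g. g \<in> carrier G} < r"
    using surj_card_le[OF _ sub] prime_gt_0_nat[OF r] by simp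
qed

text \<open>The commutator of \<open>y\<close> and \<open>u\<close> lies in the intersection of
  \<open>N\<close> and \<open>U\<close> but not in \<open>A\<close>. So the product \<open>M\<close>
  of that intersection with \<open>A\<close>, a normal subgroup strictly above \<open>A\<close>, is
  all of \<open>U\<close>.\<close>

lemma z_in_normal:
  assumes N: "N \<lhd> G" and y: "y \<in> N" and u: "u \<in> U" "conj_by y u \<otimes> inv u \<notin> A"
  shows "z \<in> N"
proof -
  have NG: "x \<in> carrier G" if "x \<in> N" for x using that N normal_in_carrier by blast
  define M where "M = {x \<otimes> a | x a. x \<in> N \<inter> U \<and> a \<in> A}"
  have comm: "a \<otimes> x = x \<otimes> a" if "a \<in> A" "x \<in> U" for a x
    using central[OF that] that by (simp add: conj_fix_iff)
  have "M \<lhd> G"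
  proof (rule normalI')
    show "M \<subseteq> carrier G" by (auto simp: M_def)
    show "\<one> \<in> M"
      unfolding M_def using normal_one N U_normal A_normal by (auto intro!: exI[of _ \<one>])
    fix m assume "m \<in> M"
    then obtain x a where m: "m = x \<otimes> a" "x \<in> N" "x \<in> U" "a \<in> A" unfolding M_def by blast
    have "inv m = inv x \<otimes> inv a"
      using m comm[OF m(4,3)] inv_mult_group[of a x] by simp
    then show "inv m \<in> M"
      unfolding M_def using m normal_inv N U_normal A_normal by blast
    show "m \<otimes> m' \<in> M" if m'M: "m' \<in> M" for m'
    proof -
      obtain x' a' where m': "m' = x' \<otimes> a'" "x' \<in> N" "x' \<in> U" "a' \<in> A" using m'M unfolding M_def by blast
      have "m \<otimes> m' = x \<otimes> (a \<otimes> x') \<otimes> a'"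
        using m m' by (simp add: m_assoc)
      also have "\<dots> = (x \<otimes> x') \<otimes> (a \<otimes> a')"
        unfolding comm[OF m(4) m'(3)] using m m' by (simp add: m_assoc)
      finally show ?thesis
        unfolding M_def using m m' normal_mult N U_normal A_normal by blast
    qed
    show "conj_by g m \<in> M" if "g \<in> carrier G" for g
    proof -
      have "conj_by g m = conj_by g x \<otimes> conj_by g a"
        using m that by (simp add: conj_mult)
      then show ?thesis
        unfolding M_def using m that normal_conj N U_normal A_normal by blast
    qed
  qed
  moreover have "A \<subseteq> M"
  proof
    fix a assume "a \<in> A"
    then have "a = \<one> \<otimes> a" "\<one> \<in> N \<inter> U"
      using normal_one N U_normal by auto
    then show "a \<in> M" unfolding M_def using \<open>a \<in> A\<close> by blast
  qed
  moreover have "M \<subseteq> U"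
    unfolding M_def using A_sub_U U_normal normal_mult by blast
  moreover have "conj_by y u \<otimes> inv u \<in> M"
  proof -
    have "conj_by y u \<otimes> inv u = y \<otimes> conj_by u (inv y)"
      using NG[OF y] u(1) by (simp add: conj_by_def m_assoc)
    then have "conj_by y u \<otimes> inv u \<in> N"
      using y u(1) N normal_mult normal_conj normal_inv by simp
    moreover have "conj_by y u \<otimes> inv u \<in> U"
      using NG[OF y] u(1) U_normal normal_mult normal_conj normal_inv by simp
    moreover have "conj_by y u \<otimes> inv u = conj_by y u \<otimes> inv u \<otimes> \<one>"
      using NG[OF y] u(1) by simp
    ultimately show ?thesis
      unfolding M_def using normal_one[OF A_normal] by blast
  qed
  ultimately have "M = U" using chief u(2) by blast
  \<comment> \<open>The factors from \<open>A\<close> are central in \<open>U\<close> and drop out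
    of the commutator, so \<open>z\<close> is the commutator of \<open>x1\<close> and
    \<open>x2\<close>, which lie in \<open>N\<close>.\<close>
  then obtain x1 a1 x2 a2 where x: "u1 = x1 \<otimes> a1" "x1 \<in> N" "x1 \<in> U" "a1 \<in> A"
    "u2 = x2 \<otimes> a2" "x2 \<in> N" "x2 \<in> U" "a2 \<in> A"
    using u1 u2 unfolding M_def by blast
  have "conj_by a1 u2 = u2"
    using comm[OF x(4) u2] x(4) u2 by (simp add: conj_fix_iff)
  then have "conj_by u1 u2 = conj_by x1 u2"
    using x(1,3,4) u2 by (simp add: conj_comp)
  also have "\<dots> = conj_by x1 x2 \<otimes> a2"
    using x central[OF x(8) x(3)] by (simp add: conj_mult)
  finally have "z = conj_by x1 x2 \<otimes> a2 \<otimes> inv u2"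
    by (simp add: z_def)
  also have "\<dots> = conj_by x1 x2 \<otimes> inv x2"
    using x by (simp add: inv_mult_group m_assoc cancel_inv)
  finally show ?thesis
    using x N NG normal_conj normal_inv normal_mult by simp
qed

text \<open>Otherwise \<open>x\<close> and \<open>x \<otimes> z\<close> lie in the same normal subgroups, although only one of them has order
  divisible by \<open>r\<close>.\<close>

lemma coprime_element_trivial:
  assumes x: "x \<in> carrier G" "conj_by x z = z" "\<not> r dvd ord x" and u: "u \<in> U"
  shows "conj_by x u \<otimes> inv u \<in> A"
proof (rule ccontr)
  assume nt: "\<not> ?thesis"
  define y where "y = x \<otimes> z"
  have y: "y \<in> carrier G" using x y_def by simp
  have "conj_by z u = u"
    using central[OF z_A u] u by (simp add: conj_fix_sym)
  then have "conj_by y u = conj_by x u"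
    unfolding y_def using x(1) u by (simp add: conj_comp)
  then have nty: "conj_by y u \<otimes> inv u \<notin> A" using nt by simp
  have "x \<in> N \<longleftrightarrow> y \<in> N" if N: "N \<lhd> G" for N
  proof
    show "y \<in> N" if "x \<in> N"
      unfolding y_def using normal_mult[OF N that z_in_normal[OF N that u nt]] .
    show "x \<in> N" if "y \<in> N"
    proof -
      have "y \<otimes> inv z \<in> N"
        using normal_mult[OF N that normal_inv[OF N z_in_normal[OF N that u nty]]] .
      then show ?thesis unfolding y_def using x(1) by (simp add: m_assoc)
    qed
  qed
  then obtain g where g: "g \<in> carrier G" "y = conj_by g x \<or> inv y = conj_by g x"
    using magnus_discreteD[OF magnus x(1) y] unfolding conj_by_def by blast
  then have "ord y = ord x"
    using x(1) y conj_ord ord_inv by metis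
  then have "y [^] ord x = \<one>"
    using y by (metis pow_ord_eq_1)
  moreover have "y [^] ord x = x [^] ord x \<otimes> z [^] ord x"
    unfolding y_def using x by (intro pow_mult_distrib) (simp_all add: conj_fix_iff)
  ultimately have "z [^] ord x = \<one>" using x(1) by simp
  then show False using x(3) by (simp add: pow_eq_id ord_z)
qed

section \<open>Counting the cosets in \<open>U / A\<close>\<close>

abbreviation "X \<equiv> (\<lambda>x. A #> x) ` U"

lemma X_finite: "finite X"
  by (rule finite_imageI, rule finite_subset[OF _ finite_carrier]) auto

lemma ord_coset:
  assumes "u \<in> U" "u \<notin> A"
  shows "q.H.ord (A #> u) = r"
proof -
  have "(A #> u) [^]\<^bsub>Q\<^esub> r = \<one>\<^bsub>Q\<^esub>"
    using assms exponent by (simp add: one_FactGroup r_coset_eq_self_iff[OF A_normal] flip: q.hom_nat_pow)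
  then have "q.H.ord (A #> u) dvd r"
    using assms by (simp add: q.H.pow_eq_id)
  moreover have "q.H.ord (A #> u) \<noteq> 1"
    using assms q.H.ord_eq_1[of "A #> u"] by (simp add: one_FactGroup r_coset_eq_self_iff[OF A_normal])
  ultimately show ?thesis using r by (auto simp: prime_nat_iff)
qed

lemma ex_U_not_A: "\<exists>u. u \<in> U \<and> u \<notin> A"
  using A_sub_U A_neq_U by blast

lemma r_dvd_card_X: "r dvd card X"
proof -
  obtain u where u: "u \<in> U" "u \<notin> A" using ex_U_not_A by blast
  have sub: "subgroup X Q"
    using q_minimal normal_imp_subgroup unfolding minimal_normal_def by blast
  interpret X: group "Q\<lparr>carrier := X\<rparr>"
    using sub by (rule q.H.subgroup_imp_group)
  have "(A #> u) [^]\<^bsub>Q\<^esub> card X = \<one>\<^bsub>Q\<^esub>"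
    using X.pow_order_eq_1[of "A #> u"] u by (simp add: order_def flip: q.H.nat_pow_consistent)
  then show ?thesis
    using ord_coset[OF u] u q.H.pow_eq_id[of "A #> u"] by simp
qed

text \<open>If \<open>U / A\<close> had order \<open>r\<close>, one coset \<open>A #> u\<close>
  would generate it. Every element of \<open>U\<close> would be a power of \<open>u\<close> times an
  element of the central subgroup \<open>A\<close>, so \<open>U\<close> would be abelian, against
  \<open>noncomm\<close>.\<close>

lemma card_X_neq_r: "card X \<noteq> r"
proof
  assume card: "card X = r"
  obtain u where u: "u \<in> U" "u \<notin> A" using ex_U_not_A by blast
  have uQ: "A #> u \<in> carrier Q" using u by simp
  have finQ: "finite (carrier Q)"
    using q_magnus finite_magnus_group.finite_carrier by blast
  have "inj_on (\<lambda>k. A #> (u [^] k)) {0..q.H.ord (A #> u) - 1}"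
    using q.H.ord_inj[OF uQ] u by (simp add: q.hom_nat_pow)
  then have "card ((\<lambda>k. A #> (u [^] k)) ` {0..r - 1}) = r"
    using card_image[of "\<lambda>k. A #> (u [^] k)" "{0..r - 1}"] prime_gt_0_nat[OF r]
    by (simp add: ord_coset[OF u])
  moreover have "(\<lambda>k. A #> (u [^] k)) ` {0..r - 1} \<subseteq> X"
    using u normal_pow[OF U_normal] by blast
  ultimately have X: "X = (\<lambda>k. A #> (u [^] k)) ` {0..r - 1}"
    using X_finite card by (metis card_subset_eq)
  have rep: "\<exists>a\<in>A. \<exists>k::nat. w = a \<otimes> u [^] k" if w: "w \<in> U" for w
  proof -
    have "A #> w \<in> (\<lambda>k. A #> (u [^] k)) ` {0..r - 1}"
      unfolding X[symmetric] using w by (rule imageI)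
    then obtain k :: nat where "A #> w = A #> (u [^] k)" by blast
    then have "w \<otimes> inv (u [^] k) \<in> A"
      using w u by (simp add: r_coset_eq_iff[OF A_normal])
    moreover have "w = w \<otimes> inv (u [^] k) \<otimes> u [^] k"
      using w u by (simp add: m_assoc)
    ultimately show ?thesis by blast
  qed
  obtain a b and i j :: nat where ab: "a \<in> A" "b \<in> A" "u1 = a \<otimes> u [^] i" "u2 = b \<otimes> u [^] j"
    using rep u1 u2 by meson
  have pw: "u [^] i \<in> U" "u [^] j \<in> U" using u normal_pow[OF U_normal] by blast+
  have "conj_by (u [^] i) u2 = conj_by (u [^] i) b \<otimes> conj_by (u [^] i) (u [^] j)"
    unfolding ab(4) using ab u pw by (simp add: conj_mult)
  also have "conj_by (u [^] i) (u [^] j) = u [^] j"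
    using u by (simp add: conj_fix_iff nat_pow_mult add.commute)
  finally have "conj_by (u [^] i) u2 = u2"
    using central[OF ab(2) pw(1)] ab(4) by simp
  moreover have "conj_by a u2 = u2"
    using central[OF ab(1) u2] ab(1) u2 by (simp add: conj_fix_sym)
  ultimately have "conj_by u1 u2 = u2"
    unfolding ab(3) using ab(1) u u2 by (simp add: conj_comp)
  then show False using noncomm by blast
qed

text \<open>A Sylow \<open>r\<close>-subgroup \<open>R\<close> of the centralizer \<open>C\<close>
  of \<open>z\<close> fixes a nontrivial coset, since \<open>r\<close> divides
  \<open>card X\<close>. For other primes the Sylow subgroups of \<open>C\<close> fix every coset by
  \<open>coprime_element_trivial\<close>. The stabilizer \<open>S\<close> of the coset in
  \<open>C\<close> therefore has an order divisible by that of \<open>C\<close>.\<close>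

lemma ex_fixed_coset:
  "\<exists>u\<in>U. u \<notin> A \<and> (\<forall>c\<in>carrier G. conj_by c z = z \<longrightarrow> A #> conj_by c u = A #> u)"
proof -
  define C where "C = {c \<in> carrier G. conj_by c z = z}"
  have C: "subgroup C G"
    unfolding C_def by unfold_locales (auto simp: conj_comp intro: conj_fix_inv)
  have finC: "finite C" unfolding C_def using finite_carrier by simp
  then have "card C \<noteq> 0" using subgroup.one_closed[OF C] by auto
  \<comment> \<open>A prime that does not divide \<open>card C\<close> is included: its exponent is
    0 and the subgroup trivial, which avoids a case distinction below.\<close>
  have sylow: "\<exists>R. subgroup R G \<and> R \<subseteq> C \<and> card R = p ^ multiplicity p (card C)" if "prime p" for p
  proof -
    have "order (G\<lparr>carrier := C\<rparr>) = p ^ multiplicity p (card C) * (card C div p ^ multiplicity p (card C))"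
      by (simp add: order_def multiplicity_dvd)
    from sylow_thm[OF that subgroup_imp_group[OF C] this] finC
    obtain R where "subgroup R (G\<lparr>carrier := C\<rparr>)" "card R = p ^ multiplicity p (card C)"
      by auto
    then show ?thesis
      using incl_subgroup[OF C] subgroup.subset by fastforce
  qed
  obtain R where R: "subgroup R G" "R \<subseteq> C" "card R = r ^ multiplicity r (card C)"
    using sylow[OF r] by blast
  have RG: "g \<in> carrier G" if "g \<in> R" for g
    using subgroup.mem_carrier[OF R(1) that] .
  have "\<exists>B\<in>X. B \<noteq> A \<and> (\<forall>g\<in>carrier (G\<lparr>carrier := R\<rparr>). conj_by g ` B = B)"
  proof (rule p_group_nontrivial_fixed_point[of _ r "multiplicity r (card C)"])
    show "group (G\<lparr>carrier := R\<rparr>)" using R(1) by (rule subgroup_imp_group)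
    show "order (G\<lparr>carrier := R\<rparr>) = r ^ multiplicity r (card C)" using R(3) by (simp add: order_def)
    show "conj_by g ` B \<in> X" if "g \<in> carrier (G\<lparr>carrier := R\<rparr>)" "B \<in> X" for g B
      using that RG normal_conj[OF U_normal] by (auto simp: conj_r_coset[OF A_normal])
    show "conj_by \<one>\<^bsub>G\<lparr>carrier := R\<rparr>\<^esub> ` B = B" if B: "B \<in> X" for B
    proof -
      obtain x where "x \<in> U" "B = A #> x" using B by blast
      then show ?thesis using conj_r_coset[OF A_normal one_closed, of x] by simp
    qed
    show "conj_by (g \<otimes>\<^bsub>G\<lparr>carrier := R\<rparr>\<^esub> h) ` B = conj_by g ` conj_by h ` B"
      if gh: "g \<in> carrier (G\<lparr>carrier := R\<rparr>)" "h \<in> carrier (G\<lparr>carrier := R\<rparr>)" and B: "B \<in> X" for g h B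
    proof -
      obtain x where x: "x \<in> U" "B = A #> x" using B by blast
      have "g \<in> carrier G" "h \<in> carrier G" using gh RG by simp_all
      then show ?thesis
        using x by (simp add: conj_r_coset[OF A_normal] conj_comp del: image_image)
    qed
    have A1: "A #> \<one> = A" by (simp add: one_FactGroup)
    show "A \<in> X" using A1 normal_one[OF U_normal] by (metis image_eqI)
    show "conj_by g ` A = A" if "g \<in> carrier (G\<lparr>carrier := R\<rparr>)" for g
      using conj_r_coset[OF A_normal RG[of g] one_closed] that A1 RG[of g] by simp
  qed (use r X_finite r_dvd_card_X in auto)
  then obtain u where u: "u \<in> U" "A #> u \<noteq> A" "\<And>g. g \<in> R \<Longrightarrow> conj_by g ` (A #> u) = A #> u"
    by auto
  define S where "S = {c \<in> C. conj_by c ` (A #> u) = A #> u}"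
  have CG: "c \<in> carrier G" if "c \<in> C" for c using that C_def by blast
  have S: "subgroup S G"
  proof
    show "S \<subseteq> carrier G" unfolding S_def C_def by blast
    show "\<one> \<in> S"
      unfolding S_def using subgroup.one_closed[OF C] u(1) by (simp add: conj_r_coset[OF A_normal])
    fix c assume c: "c \<in> S"
    then have cG: "c \<in> carrier G" "c \<in> C" "A #> conj_by c u = A #> u"
      using CG u(1) unfolding S_def by (auto simp: conj_r_coset[OF A_normal])
    have "A #> u = A #> conj_by (inv c) (conj_by c u)"
      using cG u(1) by (simp add: conj_inv_cancel)
    also have "\<dots> = conj_by (inv c) ` (A #> conj_by c u)"
      using cG(1) u(1) by (simp add: conj_r_coset[OF A_normal])
    finally have "conj_by (inv c) ` (A #> u) = A #> u" unfolding cG(3) ..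
    then show "inv c \<in> S"
      unfolding S_def using subgroup.m_inv_closed[OF C cG(2)] by blast
    show "c \<otimes> d \<in> S" if d: "d \<in> S" for d
    proof -
      have dG: "d \<in> carrier G" "d \<in> C" "A #> conj_by d u = A #> u"
        using d CG u(1) unfolding S_def by (auto simp: conj_r_coset[OF A_normal])
      have "A #> conj_by (c \<otimes> d) u = conj_by c ` (A #> conj_by d u)"
        using cG(1) dG(1) u(1) by (simp add: conj_r_coset[OF A_normal] conj_comp)
      also have "\<dots> = A #> u"
        unfolding dG(3) using cG u(1) by (simp add: conj_r_coset[OF A_normal])
      finally show ?thesis
        unfolding S_def using cG dG u(1) subgroup.m_closed[OF C]
        by (simp add: conj_r_coset[OF A_normal])
    qed
  qed
  interpret S: group "G\<lparr>carrier := S\<rparr>" using S by (rule subgroup_imp_group)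
  have finS: "finite S" using finC unfolding S_def by simp
  have dvdS: "card P dvd card S" if P: "subgroup P G" "P \<subseteq> S" for P
  proof -
    have "subgroup P (G\<lparr>carrier := S\<rparr>)"
      using P S subgroup_incl by blast
    then show ?thesis
      using S.lagrange[of P] by (metis dvd_triv_right order_def partial_object.simps(1) partial_object.surjective
          partial_object.update_convs(1))
  qed
  have "card C dvd card S"
  proof (rule multiplicity_le_imp_dvd)
    fix q :: nat assume q: "prime q"
    obtain P where P: "subgroup P G" "P \<subseteq> C" "card P = q ^ multiplicity q (card C)"
      using sylow[OF q] by blast
    have "\<exists>P. subgroup P G \<and> P \<subseteq> S \<and> card P = q ^ multiplicity q (card C)"
    proof (cases "q = r")
      case True
      have "R \<subseteq> S" unfolding S_def using R(2) u(3) by blast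
      then show ?thesis using R True by blast
    next
      case False
      interpret P: group "G\<lparr>carrier := P\<rparr>" using P(1) by (rule subgroup_imp_group)
      have "x \<in> S" if x: "x \<in> P" for x
      proof -
        have xC: "x \<in> C" "x \<in> carrier G" using x P CG by auto
        have "x [^] card P = \<one>"
          using P.pow_order_eq_1[of x] x by (simp add: order_def flip: nat_pow_consistent)
        then have "ord x dvd q ^ multiplicity q (card C)"
          using xC by (simp add: pow_eq_id P(3))
        then have "\<not> r dvd ord x"
          using False primes_dvd_imp_eq[OF r q] prime_dvd_power[OF r, of q] dvd_trans by metis
        then have "conj_by x u \<otimes> inv u \<in> A"
          using coprime_element_trivial[OF xC(2) _ _ u(1)] xC(1) unfolding C_def by simp
        then have "A #> conj_by x u = A #> u"
          using xC u(1) by (simp add: r_coset_eq_iff[OF A_normal])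
        then show ?thesis
          unfolding S_def using xC u(1) by (simp add: conj_r_coset[OF A_normal])
      qed
      then show ?thesis using P by blast
    qed
    then have "q ^ multiplicity q (card C) dvd card S"
      using dvdS by metis
    moreover have "card S \<noteq> 0" using finS subgroup.one_closed[OF S] by auto
    ultimately show "multiplicity q (card C) \<le> multiplicity q (card S)"
      using q by (intro multiplicity_geI) (auto simp: prime_nat_iff)
  qed (rule \<open>card C \<noteq> 0\<close>)
  moreover have "card S \<noteq> 0" using finS subgroup.one_closed[OF S] by auto
  ultimately have "card C \<le> card S" by (simp add: dvd_imp_le)
  then have "S = C"
    using finC by (intro card_seteq) (auto simp: S_def)
  then have "A #> conj_by c u = A #> u" if "c \<in> carrier G" "conj_by c z = z" for c
  proof -
    have "c \<in> S" unfolding \<open>S = C\<close> C_def using that by simp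
    then have "conj_by c ` (A #> u) = A #> u" unfolding S_def by blast
    then show ?thesis using that(1) u(1) by (simp add: conj_r_coset[OF A_normal])
  qed
  moreover have "u \<notin> A" using u(1,2) by (simp add: r_coset_eq_self_iff[OF A_normal])
  ultimately show ?thesis using u(1) by blast
qed

text \<open>The cosets other than \<open>A\<close> form one orbit up to inversion, and this orbit is no larger than the
  conjugacy class of \<open>z\<close>. So \<open>U / A\<close> has at most \<open>2 (r - 1) + 1\<close> elements, which leaves only order \<open>r\<close>.\<close>

lemma contradiction: False
proof -
  obtain u where u: "u \<in> U" "u \<notin> A"
    and fixed: "\<And>c. c \<in> carrier G \<Longrightarrow> conj_by c z = z \<Longrightarrow> A #> conj_by c u = A #> u"
    using ex_fixed_coset by blast
  let ?Z = "{conj_by g z | g. g \<in> carrier G}"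
  \<comment> \<open>\<open>t w\<close> picks an element conjugating \<open>z\<close> to
    \<open>w\<close>. Two choices differ by an element centralizing \<open>z\<close>, which fixes
    the coset of \<open>u\<close>, so \<open>A #> conj_by g u\<close> depends only on
    \<open>conj_by g z\<close>.\<close>
  define t where "t w = (SOME g. g \<in> carrier G \<and> conj_by g z = w)" for w
  have t: "t (conj_by g z) \<in> carrier G" "A #> conj_by g u = A #> conj_by (t (conj_by g z)) u"
    if g: "g \<in> carrier G" for g
  proof -
    let ?h = "t (conj_by g z)"
    have h: "?h \<in> carrier G" "conj_by ?h z = conj_by g z"
      unfolding t_def using someI[of "\<lambda>h. h \<in> carrier G \<and> conj_by h z = conj_by g z" g] g by auto
    show "?h \<in> carrier G" by fact
    have "conj_by (inv ?h \<otimes> g) z = conj_by (inv ?h) (conj_by ?h z)"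
      using g h by (simp add: conj_comp)
    also have "\<dots> = z"
      using h(1) by (simp add: conj_inv_cancel)
    finally have "A #> conj_by (inv ?h \<otimes> g) u = A #> u"
      using g h(1) by (intro fixed) auto
    then have "conj_by ?h ` (A #> conj_by (inv ?h \<otimes> g) u) = conj_by ?h ` (A #> u)" by simp
    moreover have "conj_by ?h (conj_by (inv ?h \<otimes> g) u) = conj_by g u"
      using g h(1) u(1) by (simp add: conj_comp conj_inv_cancel)
    ultimately show "A #> conj_by g u = A #> conj_by ?h u"
      using g h(1) u(1) by (simp add: conj_r_coset[OF A_normal])
  qed
  define f1 where "f1 w = A #> conj_by (t w) u" for w
  define f2 where "f2 w = A #> inv (conj_by (t w) u)" for w
  have "X \<subseteq> {A} \<union> f1 ` ?Z \<union> f2 ` ?Z"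
  proof
    fix B assume "B \<in> X"
    then obtain v where v: "v \<in> U" "B = A #> v" by blast
    show "B \<in> {A} \<union> f1 ` ?Z \<union> f2 ` ?Z"
    proof (cases "v \<in> A")
      case True
      then show ?thesis using v by (simp add: r_coset_eq_self_iff[OF A_normal])
    next
      case False
      obtain g where g: "g \<in> carrier G" "B = A #> conj_by g u \<or> B = A #> inv (conj_by g u)"
        using section_conj[OF u v(1) False] v(2) by blast
      have "A #> inv (conj_by g u) = f2 (conj_by g z)"
        unfolding f2_def using t[OF g(1)] g(1) u(1) q.hom_inv by (metis U_carrier conj_closed)
      moreover have "A #> conj_by g u = f1 (conj_by g z)"
        unfolding f1_def using t(2)[OF g(1)] .
      ultimately show ?thesis using g by blast
    qed
  qed
  then have "card X \<le> card ({A} \<union> f1 ` ?Z \<union> f2 ` ?Z)"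
    using card_conj_z(1) by (intro card_mono) auto
  also have "\<dots> \<le> card {A} + card (f1 ` ?Z) + card (f2 ` ?Z)"
    by (meson add_mono card_Un_le le_refl order_trans)
  also have "\<dots> \<le> 1 + card ?Z + card ?Z"
    using card_image_le[OF card_conj_z(1)] by (intro add_mono) auto
  also have "\<dots> < 2 * r"
    using card_conj_z(2) by linarith
  finally have "card X < 2 * r" .
  moreover obtain m where m: "card X = r * m" using r_dvd_card_X by blast
  moreover have "card X \<noteq> 0" using X_finite u by auto
  ultimately have "m < 2" "m \<noteq> 0" by (auto simp: mult.commute)
  then show False using m card_X_neq_r by (auto simp: less_2_cases_iff)
qed

end

section \<open>The second derived subgroup of a finite group\<close>

text \<open>A maximal abelian normal subgroup \<open>A\<close> works. If its centralizer were
  larger, a minimal normal subgroup \<open>U\<close> strictly above \<open>A\<close> inside it would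
  be nonabelian by maximality and satisfy the contradictory locale. As \<open>A\<close> is chosen in
  the proof, \<open>cyclic\<close> speaks of all abelian normal subgroups.\<close>

lemma (in finite_magnus_group) abelian_normal_self_centralizing:
  assumes cyclic: "\<And>A (r::nat) a b. \<lbrakk>A \<lhd> G; \<And>x y. x \<in> A \<Longrightarrow> y \<in> A \<Longrightarrow> conj_by x y = y; prime r;
      a \<in> A; b \<in> A; a [^] r = \<one>; b [^] r = \<one>; a \<noteq> \<one>\<rbrakk> \<Longrightarrow> \<exists>k::nat. b = a [^] k"
  shows "\<exists>A. A \<lhd> G \<and> centralizer A = A"
proof -
  define \<A> where "\<A> = {A. A \<lhd> G \<and> (\<forall>x\<in>A. \<forall>y\<in>A. conj_by x y = y)}"
  have "\<A> \<subseteq> Pow (carrier G)"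
    unfolding \<A>_def using normal_in_carrier by blast
  then have "finite \<A>"
    using finite_carrier finite_subset by blast
  moreover have "{\<one>} \<in> \<A>"
    unfolding \<A>_def using one_is_normal by simp
  ultimately obtain A where A: "A \<in> \<A>" and max: "\<And>B. B \<in> \<A> \<Longrightarrow> A \<subseteq> B \<Longrightarrow> A = B"
    using finite_has_maximal[of \<A>] by blast
  have A_normal: "A \<lhd> G" and A_comm: "\<And>x y. x \<in> A \<Longrightarrow> y \<in> A \<Longrightarrow> conj_by x y = y"
    using A unfolding \<A>_def by blast+
  define D where "D = centralizer A"
  have D: "D \<lhd> G" unfolding D_def by (rule centralizer_normal) fact
  have "A \<subseteq> D"
    unfolding D_def centralizer_def using A_comm normal_in_carrier[OF A_normal] by blast
  have "D = A"
  proof (rule ccontr)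
    assume "D \<noteq> A"
    define \<U> where "\<U> = {U. U \<lhd> G \<and> A \<subseteq> U \<and> A \<noteq> U \<and> U \<subseteq> D}"
    have "\<U> \<subseteq> Pow (carrier G)"
      unfolding \<U>_def using normal_in_carrier by blast
    then have "finite \<U>"
      using finite_carrier finite_subset by blast
    moreover have "D \<in> \<U>"
      unfolding \<U>_def using D \<open>A \<subseteq> D\<close> \<open>D \<noteq> A\<close> by blast
    ultimately obtain U where U: "U \<in> \<U>" and min: "\<And>N. N \<in> \<U> \<Longrightarrow> N \<subseteq> U \<Longrightarrow> U = N"
      using finite_has_minimal[of \<U>] by blast
    have U': "U \<lhd> G" "A \<subseteq> U" "A \<noteq> U" "U \<subseteq> D"
      using U unfolding \<U>_def by blast+
    interpret magnus_chief_section G A U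
    proof (intro magnus_chief_section.intro magnus_chief_section_axioms.intro)
      show "N = A \<or> N = U" if "N \<lhd> G" "A \<subseteq> N" "N \<subseteq> U" for N
        using min[of N] that U'(4) unfolding \<U>_def by blast
    qed (fact A_normal U' finite_magnus_group_axioms)+
    have central: "conj_by u a = a" if "a \<in> A" "u \<in> U" for a u
      using that U'(4) unfolding D_def centralizer_def by blast
    obtain r :: nat where r: "prime r" "\<And>u. u \<in> U \<Longrightarrow> u [^] r \<in> A"
      using section_exponent by blast
    have "U \<notin> \<A>" using max[of U] U' by blast
    then obtain u1 u2 where u: "u1 \<in> U" "u2 \<in> U" "conj_by u1 u2 \<noteq> u2"
      unfolding \<A>_def using U'(1) by blast
    interpret magnus_central_section G A U r u1 u2
      by unfold_locales (use r central u cyclic[OF A_normal A_comm r(1)] in blast)+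
    show False by (rule contradiction)
  qed
  then show ?thesis
    using A_normal unfolding D_def by blast
qed

text \<open>Induction on the order: the \<open>r\<close>-th powers of \<open>a\<close> and
  \<open>b\<close> have equal smaller order, so \<open>b\<close> times the inverse of some
  \<open>a [^] k\<close> has trivial \<open>r\<close>-th power. By \<open>cyclic\<close> it is a
  power of \<open>a [^] (ord a div r)\<close>, an element of order \<open>r\<close>.\<close>

lemma (in group) same_order_power:
  assumes "finite (carrier G)" "A \<lhd> G" "\<And>x y. x \<in> A \<Longrightarrow> y \<in> A \<Longrightarrow> x \<otimes> y = y \<otimes> x"
    and cyclic: "\<And>(r::nat) a b. \<lbrakk>prime r; a \<in> A; b \<in> A; a [^] r = \<one>; b [^] r = \<one>; a \<noteq> \<one>\<rbrakk>
      \<Longrightarrow> \<exists>k::nat. b = a [^] k"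
    and "a \<in> A" "b \<in> A" "ord a = ord b"
  shows "\<exists>k::nat. b = a [^] k"
  using assms(5-7)
proof (induction "ord a" arbitrary: a b rule: less_induct)
  case less
  note ab = less.prems(1,2)
  have AG: "x \<in> carrier G" if "x \<in> A" for x using that assms(2) normal_in_carrier by blast
  have pos: "ord a > 0" using ord_ge_1[OF assms(1) AG[OF ab(1)]] by simp
  show ?case
  proof (cases "ord a = 1")
    case True
    then have "a = \<one>" "b = \<one>" using less.prems AG ord_eq_1 by metis+
    then show ?thesis by (metis nat_pow_0)
  next
    case False
    then obtain r where r: "prime r" "r dvd ord a" using prime_factor_nat by blast
    have r0: "r \<noteq> 0" "r > 1" using r(1) prime_gt_1_nat by (auto intro: gr0I)
    have ords: "ord (a [^] r) = ord a div r" "ord (b [^] r) = ord a div r"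
      using ord_pow[of a r] ord_pow[of b r] r r0 ab AG less.prems(3) by auto
    have "ord (a [^] r) < ord a" using ords(1) pos r0 by simp
    then obtain k :: nat where k: "b [^] r = (a [^] r) [^] k"
      using less.hyps[of "a [^] r" "b [^] r"] ords ab normal_pow[OF assms(2)] by auto
    define c where "c = b \<otimes> inv (a [^] k)"
    have akA: "a [^] k \<in> A" using ab normal_pow[OF assms(2)] by blast
    have cA: "c \<in> A" unfolding c_def using ab akA normal_mult normal_inv assms(2) by blast
    have "c [^] r = b [^] r \<otimes> inv (a [^] k) [^] r"
      unfolding c_def using ab akA AG assms(3) normal_inv[OF assms(2)] by (intro pow_mult_distrib) auto
    also have "inv (a [^] k) [^] r = inv ((a [^] r) [^] k)"
      using ab AG by (simp add: nat_pow_inv nat_pow_pow mult.commute)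
    finally have c: "c [^] r = \<one>" using k ab AG by simp
    define a' where "a' = a [^] (ord a div r)"
    have a': "a' \<in> A" "a' [^] r = \<one>"
      unfolding a'_def using ab AG r normal_pow[OF assms(2)] by (simp_all add: nat_pow_pow)
    have "ord a div r < ord a" "ord a div r > 0"
      using pos r r0 by (auto simp: dvd_div_eq_0_iff dvd_imp_le div_greater_zero_iff)
    then have "a' \<noteq> \<one>"
      unfolding a'_def using ab AG by (auto simp: pow_eq_id dest: dvd_imp_le)
    then obtain j :: nat where j: "c = a' [^] j"
      using cyclic[OF r(1) a'(1) cA a'(2) c] by blast
    have "b = c \<otimes> a [^] k"
      unfolding c_def using ab AG by (simp add: m_assoc)
    also have "\<dots> = a [^] (ord a div r * j + k)"
      unfolding j a'_def using ab AG by (simp add: nat_pow_pow nat_pow_mult)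
    finally show ?thesis by blast
  qed
qed

text \<open>A conjugate of an element of \<open>A\<close> has the same order, so it is a power of
  that element. Such automorphisms of \<open>A\<close> commute, so commutators of \<open>G\<close>
  centralize \<open>A\<close> and lie in \<open>A\<close>, which is abelian.\<close>

lemma (in finite_magnus_group) derived_abelian:
  assumes cyclic: "\<And>A (r::nat) a b. \<lbrakk>A \<lhd> G; \<And>x y. x \<in> A \<Longrightarrow> y \<in> A \<Longrightarrow> conj_by x y = y; prime r;
      a \<in> A; b \<in> A; a [^] r = \<one>; b [^] r = \<one>; a \<noteq> \<one>\<rbrakk> \<Longrightarrow> \<exists>k::nat. b = a [^] k"
  shows "derived G (derived G (carrier G)) = {\<one>}"
proof -
  obtain A where A: "A \<lhd> G" "centralizer A = A"
  proof -
    have "\<exists>A. A \<lhd> G \<and> centralizer A = A"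
      by (rule abelian_normal_self_centralizing) (fact cyclic)
    then show ?thesis using that by blast
  qed
  have AG: "x \<in> carrier G" if "x \<in> A" for x using that A(1) normal_in_carrier by blast
  have fixed: "conj_by x y = y" if "x \<in> A" "y \<in> A" for x y
    using that A(2) unfolding centralizer_def by blast
  have comm: "x \<otimes> y = y \<otimes> x" if "x \<in> A" "y \<in> A" for x y
    using fixed[OF that] that AG by (simp add: conj_fix_iff)
  have power: "\<exists>k::nat. conj_by g a = a [^] k" if "g \<in> carrier G" "a \<in> A" for g a
  proof (rule same_order_power[OF finite_carrier A(1) comm])
    show "\<exists>k::nat. b = a [^] k"
      if "prime r" "a \<in> A" "b \<in> A" "a [^] r = \<one>" "b [^] r = \<one>" "a \<noteq> \<one>" for r :: nat and a b
      using cyclic[OF A(1) fixed] that by blast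
  qed (use that AG A(1) normal_conj conj_ord in auto)
  have "g \<otimes> h \<otimes> inv g \<otimes> inv h \<in> A" if gh: "g \<in> carrier G" "h \<in> carrier G" for g h
  proof -
    have "conj_by (g \<otimes> h \<otimes> inv g \<otimes> inv h) a = a" if a: "a \<in> A" for a
    proof -
      \<comment> \<open>Chosen so that the commutator sends \<open>a\<close> to the image of
        \<open>b\<close> under \<open>h\<close> and then \<open>g\<close>, while \<open>a\<close> is
        the image of \<open>b\<close> under \<open>g\<close> and then \<open>h\<close>.\<close>
      define b where "b = conj_by (inv g) (conj_by (inv h) a)"
      have bA: "b \<in> A" unfolding b_def using a gh A(1) normal_conj by simp
      obtain i j :: nat where ij: "conj_by g b = b [^] i" "conj_by h b = b [^] j"
        using power gh bA by metis
      have "conj_by (g \<otimes> h \<otimes> inv g \<otimes> inv h) a = conj_by g (conj_by h b)"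
        using gh AG[OF a] by (simp add: b_def conj_comp)
      also have "\<dots> = conj_by h (conj_by g b)"
        using gh AG[OF bA] by (simp add: ij conj_pow nat_pow_pow mult.commute)
      also have "\<dots> = a"
        using gh AG[OF a] by (simp add: b_def conj_inv_cancel)
      finally show ?thesis .
    qed
    then have "g \<otimes> h \<otimes> inv g \<otimes> inv h \<in> centralizer A"
      unfolding centralizer_def using gh by simp
    then show ?thesis using A(2) by simp
  qed
  then have "derived G (carrier G) \<subseteq> A"
    unfolding derived_def by (intro generate_subgroup_incl normal_imp_subgroup A(1)) auto
  then have "derived_set G (derived G (carrier G)) \<subseteq> {\<one>}"
  proof -
    have "x \<otimes> y \<otimes> inv x \<otimes> inv y = \<one>" if "x \<in> A" "y \<in> A" for x y
      unfolding comm[OF that] using that AG by (simp add: m_assoc cancel_inv)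
    then show ?thesis
      using \<open>derived G (carrier G) \<subseteq> A\<close> by blast
  qed
  then show ?thesis
    unfolding derived_def[of G "derived G (carrier G)"]
    using generate_subgroup_incl[OF _ triv_subgroup] generate.one by blast
qed

text \<open>In the quotient by the centralizer \<open>C\<close> of \<open>V\<close>, an abelian
  normal subgroup has at most one subgroup of each prime order by \<open>prime_order_cyclic\<close>.
  So \<open>derived_abelian\<close> applies there, and the second derived subgroup of
  \<open>G\<close> maps to the identity.\<close>

lemma (in finite_magnus_group) second_derived_centralizes_minimal:
  assumes V: "minimal_normal G V" and x: "x \<in> derived G (derived G (carrier G))" and v: "v \<in> V"
  shows "conj_by x v = v"
proof -
  have V_normal: "V \<lhd> G" using V unfolding minimal_normal_def by blast
  have VG: "v \<in> carrier G" if "v \<in> V" for v using that V_normal normal_in_carrier by blast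
  define C where "C = centralizer V"
  have C: "C \<lhd> G" unfolding C_def by (rule centralizer_normal[OF V_normal])
  have CI: "x \<in> C \<longleftrightarrow> x \<in> carrier G \<and> (\<forall>v\<in>V. conj_by x v = v)" for x
    unfolding C_def centralizer_def by blast
  let ?Q = "G Mod C"
  interpret q: group_hom G ?Q "\<lambda>x. C #> x"
    by (rule normal.quotient_map(1)[OF C])
  note surj = normal.quotient_map(2)[OF C]
  interpret Q: finite_magnus_group ?Q
    by (rule finite_magnus_image[OF q.group_hom_axioms surj])
  \<comment> \<open>Cosets of \<open>C\<close> correspond to the automorphisms of \<open>V\<close>
    that \<open>G\<close> induces, so equations in the quotient become equations between
    actions.\<close>
  have eq: "C #> x = C #> y \<longleftrightarrow> (\<forall>v\<in>V. conj_by x v = conj_by y v)"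
    if xy: "x \<in> carrier G" "y \<in> carrier G" for x y
  proof
    assume "C #> x = C #> y"
    then have c: "x \<otimes> inv y \<in> C" using xy by (simp add: r_coset_eq_iff[OF C])
    show "\<forall>v\<in>V. conj_by x v = conj_by y v"
    proof
      fix v assume v: "v \<in> V"
      have "conj_by y v \<in> V" using xy v normal_conj[OF V_normal] by blast
      then have "conj_by (x \<otimes> inv y) (conj_by y v) = conj_by y v" using c CI by blast
      then show "conj_by x v = conj_by y v"
        using xy v VG by (simp add: conj_comp conj_inv_cancel)
    qed
  next
    assume a: "\<forall>v\<in>V. conj_by x v = conj_by y v"
    have "conj_by (x \<otimes> inv y) v = v" if v: "v \<in> V" for v
    proof -
      have "conj_by (inv y) v \<in> V" using xy v normal_conj[OF V_normal] by simp
      then show ?thesis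
        using a xy v VG by (simp add: conj_comp conj_inv_cancel)
    qed
    then have "x \<otimes> inv y \<in> C" using xy CI by simp
    then show "C #> x = C #> y" using xy by (simp add: r_coset_eq_iff[OF C])
  qed
  have "derived ?Q (derived ?Q (carrier ?Q)) = {\<one>\<^bsub>?Q\<^esub>}"
  proof (rule Q.derived_abelian)
    fix B and r :: nat and a' b'
    assume B: "B \<lhd> ?Q" "\<And>x y. x \<in> B \<Longrightarrow> y \<in> B \<Longrightarrow> q.H.conj_by x y = y" and r: "prime r"
      and ab': "a' \<in> B" "b' \<in> B" "a' [^]\<^bsub>?Q\<^esub> r = \<one>\<^bsub>?Q\<^esub>" "b' [^]\<^bsub>?Q\<^esub> r = \<one>\<^bsub>?Q\<^esub>" "a' \<noteq> \<one>\<^bsub>?Q\<^esub>"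
    define A where "A = {x \<in> carrier G. C #> x \<in> B}"
    have A: "A \<lhd> G" unfolding A_def by (rule q.vimage_normal[OF B(1)])
    interpret abelian_action_on_minimal_normal G V A
    proof (intro abelian_action_on_minimal_normal.intro abelian_action_on_minimal_normal_axioms.intro)
      fix a b v assume a: "a \<in> A" and b: "b \<in> A" and v: "v \<in> V"
      then have ab: "a \<in> carrier G" "b \<in> carrier G" "C #> a \<in> B" "C #> b \<in> B"
        unfolding A_def by auto
      moreover have "q.H.conj_by (C #> a) (C #> b) = C #> b"
        using B(2) ab by blast
      ultimately have "(C #> a) \<otimes>\<^bsub>?Q\<^esub> (C #> b) = (C #> b) \<otimes>\<^bsub>?Q\<^esub> (C #> a)"
        by (simp add: q.H.conj_fix_iff)
      then have "C #> (a \<otimes> b) = C #> (b \<otimes> a)"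
        using ab by simp
      then show "conj_by a (conj_by b v) = conj_by b (conj_by a v)"
        using ab v VG eq[of "a \<otimes> b" "b \<otimes> a"] by (simp flip: conj_comp)
    qed (fact V A finite_magnus_group_axioms)+
    obtain a b where a: "a \<in> carrier G" "a' = C #> a" and b: "b \<in> carrier G" "b' = C #> b"
      using ab' B(1) q.H.normal_in_carrier surj by (metis imageE)
    have AB: "a \<in> A" "b \<in> A" unfolding A_def using a b ab' by auto
    have one: "\<one>\<^bsub>?Q\<^esub> = C #> \<one>" by simp
    have "\<exists>k::nat. \<forall>v\<in>V. conj_by b v = conj_by (a [^] k) v"
    proof (rule prime_order_cyclic[OF r AB(1) _ _ AB(2)])
      have "C #> (a [^] r) = C #> \<one>" "C #> (b [^] r) = C #> \<one>"
        using ab' a b by (simp_all add: q.hom_nat_pow)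
      then show "conj_by (a [^] r) v = v" "conj_by (b [^] r) v = v" if "v \<in> V" for v
        using that a b VG eq[of "a [^] r" \<one>] eq[of "b [^] r" \<one>] by auto
      show "\<exists>v\<in>V. conj_by a v \<noteq> v"
        using ab'(5) a VG eq[of a \<one>] by auto
    qed
    then obtain k :: nat where "C #> b = C #> (a [^] k)"
      using a b eq[of b] by (metis nat_pow_closed)
    then show "\<exists>k::nat. b' = a' [^]\<^bsub>?Q\<^esub> k"
      using a b by (metis q.hom_nat_pow)
  qed
  then have "derived ?Q (derived ?Q ((\<lambda>x. C #> x) ` carrier G)) = {\<one>\<^bsub>?Q\<^esub>}"
    by (simp add: surj)
  then have "(\<lambda>x. C #> x) ` derived G (derived G (carrier G)) = {\<one>\<^bsub>?Q\<^esub>}"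
    by (simp add: q.derived_img derived_in_carrier)
  then have "C #> x = C" using x by (auto simp: one_FactGroup)
  moreover have "x \<in> carrier G"
    using x derived_in_carrier by blast
  ultimately have "x \<in> C" by (simp add: r_coset_eq_self_iff[OF C])
  then show ?thesis using v CI by blast
qed

text \<open>Let \<open>N\<close> be minimal among the normal subgroups of \<open>G\<close>
  containing a term of the lower central series of \<open>D\<close>. If \<open>N\<close> were
  nontrivial, \<open>D\<close> would centralize a chief factor \<open>N / M\<close>, and the next
  term would lie in the smaller subgroup \<open>M\<close>.\<close>

theorem (in finite_magnus_group) second_derived_nilpotent:
  "nilpotent_group (G\<lparr>carrier := derived G (derived G (carrier G))\<rparr>)"
proof -
  define D where "D = derived G (derived G (carrier G))"
  let ?D = "G\<lparr>carrier := D\<rparr>"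
  have D: "D \<lhd> G"
    unfolding D_def by (intro derived_is_normal normal_self)
  have DG: "D \<subseteq> carrier G" using D normal_in_carrier by blast
  have subD: "subgroup D G" using D by (rule normal_imp_subgroup)
  interpret D: group ?D by (rule subgroup_imp_group[OF subD])
  define \<N> where "\<N> = {N. N \<lhd> G \<and> (\<exists>n. lower_central ?D n \<subseteq> N)}"
  have "\<N> \<subseteq> Pow (carrier G)"
    unfolding \<N>_def using normal_in_carrier by blast
  then have "finite \<N>"
    using finite_carrier finite_subset by blast
  moreover have "D \<in> \<N>"
    unfolding \<N>_def using D by (auto intro: exI[of _ 0])
  ultimately obtain N where N: "N \<in> \<N>" and min: "\<And>M. M \<in> \<N> \<Longrightarrow> M \<subseteq> N \<Longrightarrow> N = M"
    using finite_has_minimal[of \<N>] by blast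
  obtain n where n: "lower_central ?D n \<subseteq> N" and N_normal: "N \<lhd> G"
    using N unfolding \<N>_def by blast
  have "N = {\<one>}"
  proof (rule ccontr)
    assume "N \<noteq> {\<one>}"
    define \<M> where "\<M> = {M. M \<lhd> G \<and> M \<subseteq> N \<and> M \<noteq> N}"
    have "\<M> \<subseteq> Pow (carrier G)"
      unfolding \<M>_def using normal_in_carrier by blast
    then have "finite \<M>"
      using finite_carrier finite_subset by blast
    moreover have "{\<one>} \<in> \<M>"
      unfolding \<M>_def using one_is_normal normal_one[OF N_normal] \<open>N \<noteq> {\<one>}\<close> by blast
    ultimately obtain M where M: "M \<in> \<M>" and max: "\<And>L. L \<in> \<M> \<Longrightarrow> M \<subseteq> L \<Longrightarrow> M = L"
      using finite_has_maximal[of \<M>] by blast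
    have M': "M \<lhd> G" "M \<subseteq> N" "M \<noteq> N" using M unfolding \<M>_def by blast+
    interpret magnus_chief_section G M N
    proof (intro magnus_chief_section.intro magnus_chief_section_axioms.intro)
      show "L = M \<or> L = N" if "L \<lhd> G" "M \<subseteq> L" "L \<subseteq> N" for L
        using max[of L] that unfolding \<M>_def by blast
    qed (fact M' N_normal finite_magnus_group_axioms)+
    interpret Q: finite_magnus_group Q by (rule q_magnus)
    have comm: "x \<otimes> y \<otimes> inv x \<otimes> inv y \<in> M" if x: "x \<in> N" and y: "y \<in> D" for x y
    proof -
      have yG: "y \<in> carrier G" using y DG by blast
      \<comment> \<open>Surjective homomorphisms carry derived subgroups onto derived subgroups, so
        the second derived subgroup of the quotient is the image of \<open>D\<close>.\<close>
      have "derived Q (derived Q (carrier Q)) = (\<lambda>x. M #> x) ` D"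
        unfolding D_def q_surj[symmetric] by (simp add: q.derived_img derived_in_carrier)
      then have "M #> y \<in> derived Q (derived Q (carrier Q))" using y by blast
      then have "q.H.conj_by (M #> y) (M #> x) = M #> x"
        using Q.second_derived_centralizes_minimal[OF q_minimal] x by blast
      then have "(M #> y) \<otimes>\<^bsub>Q\<^esub> (M #> x) = (M #> x) \<otimes>\<^bsub>Q\<^esub> (M #> y)"
        using x yG by (simp add: q.H.conj_fix_iff)
      then have "M #> (x \<otimes> y) = M #> (y \<otimes> x)"
        using x yG by simp
      then have "(x \<otimes> y) \<otimes> inv (y \<otimes> x) \<in> M"
        using x yG r_coset_eq_iff[OF M'(1), of "x \<otimes> y" "y \<otimes> x"] by simp
      then show ?thesis
        using x yG by (simp add: inv_mult_group m_assoc)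
    qed
    have lcD: "lower_central ?D n \<subseteq> D" for n
    proof (induction n)
      case (Suc n)
      have "lower_central ?D (Suc n) \<subseteq> carrier ?D"
        unfolding lower_central.simps using Suc D.inv_closed
        by (intro D.generate_incl) (auto simp: subset_iff subgroup.m_closed[OF subD])
      then show ?case by simp
    qed simp
    have "{x \<otimes>\<^bsub>?D\<^esub> y \<otimes>\<^bsub>?D\<^esub> inv\<^bsub>?D\<^esub> x \<otimes>\<^bsub>?D\<^esub> inv\<^bsub>?D\<^esub> y | x y. x \<in> lower_central ?D n \<and> y \<in> carrier ?D} \<subseteq> M \<inter> D"
      (is "?S \<subseteq> _")
    proof
      fix w assume "w \<in> ?S"
      then obtain x y where w: "w = x \<otimes>\<^bsub>?D\<^esub> y \<otimes>\<^bsub>?D\<^esub> inv\<^bsub>?D\<^esub> x \<otimes>\<^bsub>?D\<^esub> inv\<^bsub>?D\<^esub> y"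
        "x \<in> lower_central ?D n" "y \<in> carrier ?D" by blast
      then have xy: "x \<in> D" "y \<in> D" "x \<in> N" using lcD n by auto
      then have w': "w = x \<otimes> y \<otimes> inv x \<otimes> inv y"
        using w(1) m_inv_consistent[OF subD] by simp
      have "w \<in> carrier ?D"
        unfolding w(1) using xy by (intro D.m_closed D.inv_closed) auto
      then show "w \<in> M \<inter> D" using w' comm xy by simp
    qed
    then have "lower_central ?D (Suc n) \<subseteq> M \<inter> D"
      unfolding lower_central.simps
    proof (rule D.generate_subgroup_incl)
      show "subgroup (M \<inter> D) ?D"
        using subgroup_incl[OF subgroups_Inter_pair[OF normal_imp_subgroup[OF M'(1)] subD] subD] by blast
    qed
    then have "M \<in> \<N>" unfolding \<N>_def using M'(1) by blast
    then show False using min[of M] M' by blast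
  qed
  moreover have "\<one> \<in> lower_central ?D n"
    using D.one_closed by (cases n) (auto intro: generate.one[of ?D, simplified])
  ultimately have "lower_central ?D n = {\<one>\<^bsub>?D\<^esub>}" using n by auto
  then show ?thesis
    unfolding nilpotent_group_def D_def[symmetric] using D.is_group by blast
qed

section \<open>Profinite groups\<close>

lemma product_topology_cong:
  assumes "\<And>i. i \<in> I \<Longrightarrow> X i = Y i"
  shows "product_topology X I = product_topology Y I"
proof -
  have "(\<lambda>F. \<exists>i U. F = {f. f i \<in> U} \<and> i \<in> I \<and> openin (X i) U)
      = (\<lambda>F. \<exists>i U. F = {f. f i \<in> U} \<and> i \<in> I \<and> openin (Y i) U)"
    using assms by fastforce
  moreover have "topspace (product_topology X I) = topspace (product_topology Y I)"
    using assms by (simp cong: PiE_cong)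
  ultimately show ?thesis
    by (simp only: topology_eq openin_product_topology simp_thms)
qed

text \<open>An isomorphism \<open>f\<close> to an inverse limit of finite groups is fixed. Its
  coordinates need not map \<open>G\<close> onto the groups \<open>H i\<close>, so the images of
  \<open>G\<close> serve as its finite quotients.\<close>

locale profinite_presentation = topological_group G T + inverse_system I leq H \<phi>
  for G (structure) and T and I :: "'i set" and leq (infix \<open>\<preceq>\<close> 50)
    and H :: "'i \<Rightarrow> ('b, 'n) monoid_scheme" and \<phi> +
  fixes f
  assumes finite_quotients: "i \<in> I \<Longrightarrow> finite (carrier (H i))"
    and presentation:
      "topological_iso G T (inverse_limit_group I leq H \<phi>) (inverse_limit_topology I leq H \<phi>) f"
begin

abbreviation "L \<equiv> inverse_limit_carrier I leq H \<phi>"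
abbreviation "Y \<equiv> product_topology (\<lambda>i. discrete_topology (carrier (H i))) I"

definition "p i x = f x i"

lemma f_homeomorphic: "homeomorphic_map T (subtopology Y L) f"
  using presentation unfolding topological_iso_def inverse_limit_topology_def by blast

lemma f_bij: "bij_betw f (carrier G) L"
  using presentation unfolding topological_iso_def iso_def inverse_limit_group_def by auto

lemma f_mult:
  assumes "x \<in> carrier G" "y \<in> carrier G"
  shows "f (x \<otimes> y) = (\<lambda>i\<in>I. f x i \<otimes>\<^bsub>H i\<^esub> f y i)"
  using presentation assms unfolding topological_iso_def iso_def hom_def inverse_limit_group_def
  by auto

lemma f_L: "x \<in> carrier G \<Longrightarrow> f x \<in> L"
  using f_bij by (auto simp: bij_betw_def)

lemma p_closed: "i \<in> I \<Longrightarrow> x \<in> carrier G \<Longrightarrow> p i x \<in> carrier (H i)"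
  using f_L[of x] unfolding inverse_limit_carrier_def p_def by auto

lemma p_hom: "i \<in> I \<Longrightarrow> group_hom G (H i) (p i)"
  by (intro group_hom.intro group_hom_axioms.intro groups is_group homI)
    (auto simp: p_closed, auto simp: p_def f_mult)

lemma p_transition: "\<lbrakk>i \<in> I; j \<in> I; i \<preceq> j; x \<in> carrier G\<rbrakk> \<Longrightarrow> \<phi> i j (p j x) = p i x"
  using f_L[of x] unfolding inverse_limit_carrier_def p_def by auto

lemma p_continuous: "i \<in> I \<Longrightarrow> continuous_map T (discrete_topology (carrier (H i))) (p i)"
proof -
  assume i: "i \<in> I"
  have "continuous_map (subtopology Y L) (discrete_topology (carrier (H i))) (\<lambda>x. x i)"
    using continuous_map_product_projection[OF i, of "\<lambda>i. discrete_topology (carrier (H i))"]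
    by (rule continuous_map_from_subtopology)
  then have "continuous_map T (discrete_topology (carrier (H i))) ((\<lambda>x. x i) \<circ> f)"
    using homeomorphic_imp_continuous_map[OF f_homeomorphic] continuous_map_compose by blast
  then show ?thesis by (simp add: p_def[abs_def] comp_def)
qed

text \<open>The compatibility conditions equate continuous maps into discrete spaces, so
  \<open>L\<close> is closed in a product of finite discrete spaces, which is compact.\<close>

lemma compact_T: "compact_space T"
proof -
  have "closedin Y L"
  proof -
    have "L = topspace Y \<inter> \<Inter>{{x \<in> topspace Y. \<phi> i j (x j) = x i} | i j. i \<in> I \<and> j \<in> I \<and> i \<preceq> j}"
      unfolding inverse_limit_carrier_def by auto
    also have "\<dots> = \<Inter>(insert (topspace Y) {{x \<in> topspace Y. \<phi> i j (x j) = x i} | i j. i \<in> I \<and> j \<in> I \<and> i \<preceq> j})"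
      by simp
    also have "closedin Y \<dots>"
    proof (rule closedin_Inter)
      fix S assume "S \<in> insert (topspace Y) {{x \<in> topspace Y. \<phi> i j (x j) = x i} | i j. i \<in> I \<and> j \<in> I \<and> i \<preceq> j}"
      then consider "S = topspace Y"
        | i j where "S = {x \<in> topspace Y. \<phi> i j (x j) = x i}" "i \<in> I" "j \<in> I" "i \<preceq> j" by blast
      then show "closedin Y S"
      proof cases
        case 1
        then show ?thesis by (simp only: closedin_topspace)
      next
        case (2 i j)
        have proj: "continuous_map Y (discrete_topology (carrier (H i))) (\<lambda>x. x i)" if "i \<in> I" for i
          using continuous_map_product_projection[OF that, of "\<lambda>i. discrete_topology (carrier (H i))"] .
        have "continuous_map (discrete_topology (carrier (H j))) (discrete_topology (carrier (H i))) (\<phi> i j)"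
          using transition_hom[OF 2(2-4)] by (auto simp: hom_def)
        then have "continuous_map Y (discrete_topology (carrier (H i))) (\<phi> i j \<circ> (\<lambda>x. x j))"
          using proj[OF 2(3)] continuous_map_compose by blast
        then have "continuous_map Y (discrete_topology (carrier (H i))) (\<lambda>x. \<phi> i j (x j))"
          by (simp add: comp_def)
        then show ?thesis
          unfolding 2(1) using proj[OF 2(2)] by (intro closedin_continuous_maps_eq) auto
      qed
    qed simp
    finally show ?thesis .
  qed
  moreover have "compact_space Y"
    using finite_quotients by (auto simp: compact_space_product_topology compact_space_discrete_topology)
  ultimately have "compact_space (subtopology Y L)"
    by (simp add: closedin_compact_space compact_space_subtopology)
  then show ?thesis
    using f_homeomorphic homeomorphic_map_imp_homeomorphic_space homeomorphic_compact_space by blast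
qed

section \<open>Closures read off from the finite images\<close>

lemma directed_finite:
  assumes "finite J" "J \<subseteq> I"
  shows "\<exists>k\<in>I. \<forall>j\<in>J. j \<preceq> k"
  using assms
proof (induction rule: finite_induct)
  case (insert j J)
  then obtain k where k: "k \<in> I" "\<forall>j\<in>J. j \<preceq> k" by blast
  then obtain l where l: "l \<in> I" "j \<preceq> l" "k \<preceq> l" using directed[OF _ k(1), of j] insert.prems by blast
  have "i \<preceq> l" if "i \<in> J" for i
    using partial_order(2) k l that insert.prems by (meson insert_subset subsetD transp_onD)
  then show ?case using l by blast
qed (use nonempty in auto)

text \<open>Preimages of sets under \<open>p i\<close> are closed. Conversely, a basic open set
  restricts finitely many coordinates, and by directedness a single coordinate \<open>k\<close>
  above them determines them all.\<close>

lemma closure_iff: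
  assumes S: "S \<subseteq> carrier G"
  shows "x \<in> T closure_of S \<longleftrightarrow> x \<in> carrier G \<and> (\<forall>i\<in>I. p i x \<in> p i ` S)"
proof
  assume x: "x \<in> T closure_of S"
  then have xG: "x \<in> carrier G"
    using closure_of_subset_topspace[of T S] by (auto simp: topspace_eq)
  have "p i x \<in> p i ` S" if i: "i \<in> I" for i
  proof -
    have "closedin T {y \<in> topspace T. p i y \<in> p i ` S}"
      using closedin_continuous_map_preimage[OF p_continuous[OF i], of "p i ` S"] S p_closed[OF i] by auto
    then have "T closure_of S \<subseteq> {y \<in> topspace T. p i y \<in> p i ` S}"
      using S topspace_eq by (intro closure_of_minimal) auto
    then show ?thesis using x by blast
  qed
  with xG show "x \<in> carrier G \<and> (\<forall>i\<in>I. p i x \<in> p i ` S)" by blast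
next
  assume x: "x \<in> carrier G \<and> (\<forall>i\<in>I. p i x \<in> p i ` S)"
  have "\<exists>y\<in>S. y \<in> U" if U: "x \<in> U" "openin T U" for U
  proof -
    have "openin (subtopology Y L) (f ` U)"
      using homeomorphic_imp_open_map[OF f_homeomorphic] U(2) unfolding open_map_def by blast
    then obtain V where V: "openin Y V" "f ` U = V \<inter> L"
      by (auto simp: openin_subtopology)
    then have "f x \<in> V" using U by blast
    then obtain W where W: "finite {i \<in> I. W i \<noteq> topspace (discrete_topology (carrier (H i)))}"
      "f x \<in> Pi\<^sub>E I W" "Pi\<^sub>E I W \<subseteq> V"
      using V(1) unfolding openin_product_topology_alt by meson
    then obtain k where k: "k \<in> I" "\<And>j. j \<in> I \<Longrightarrow> W j \<noteq> carrier (H j) \<Longrightarrow> j \<preceq> k"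
      using directed_finite[OF W(1)] by auto
    obtain y where y: "y \<in> S" "p k y = p k x" using x k(1) by (metis imageE)
    have yG: "y \<in> carrier G" using y S by blast
    have "f y i \<in> W i" if i: "i \<in> I" for i
    proof (cases "W i = carrier (H i)")
      case True
      then show ?thesis using p_closed[OF i yG] by (simp add: p_def)
    next
      case False
      then have "p i y = p i x"
        using p_transition[OF i k(1) k(2)[OF i False]] x yG y(2) by metis
      then show ?thesis using W(2) i by (auto simp: p_def)
    qed
    moreover have "f y \<in> extensional I"
      using f_L[OF yG] unfolding inverse_limit_carrier_def by (auto simp: PiE_iff)
    ultimately have "f y \<in> Pi\<^sub>E I W"
      by (simp add: PiE_iff)
    then have "f y \<in> f ` U"
      using W(3) V(2) f_L[OF yG] by blast
    then have "y \<in> U"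
      using inj_on_image_mem_iff[OF bij_betw_imp_inj_on[OF f_bij] yG] openin_subset[OF U(2)] topspace_eq
      by auto
    with y(1) show ?thesis by blast
  qed
  then show "x \<in> T closure_of S"
    unfolding in_closure_of using x topspace_eq by blast
qed

text \<open>By \<open>closure_iff\<close>, points of the closure have no new projections. So the
  closures taken in \<open>closed_derived\<close> are invisible in the finite images.\<close>

lemma image_closure:
  assumes "S \<subseteq> carrier G" "i \<in> I"
  shows "p i ` (T closure_of S) = p i ` S"
proof -
  have "S \<subseteq> T closure_of S" using assms topspace_eq by (simp add: closure_of_subset)
  then show ?thesis using closure_iff[OF assms(1)] assms(2) by blast
qed

text \<open>By \<open>closure_iff\<close>, membership is tested in the groups \<open>H i\<close>,
  where the images of \<open>S\<close> are subgroups.\<close>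

lemma closure_subgroup:
  assumes "subgroup S G"
  shows "subgroup (T closure_of S) G"
proof -
  have SG: "S \<subseteq> carrier G" using assms by (rule subgroup.subset)
  have sub: "subgroup (p i ` S) (H i)" if "i \<in> I" for i
    using group_hom.subgroup_img_is_subgroup[OF p_hom[OF that] assms] .
  show ?thesis
  proof
    show "\<one> \<in> T closure_of S"
      unfolding closure_iff[OF SG] using subgroup.one_closed[OF assms] by blast
    fix x y assume "x \<in> T closure_of S"
    then have x: "x \<in> carrier G" "\<And>i. i \<in> I \<Longrightarrow> p i x \<in> p i ` S" unfolding closure_iff[OF SG] by blast+
    show "inv x \<in> T closure_of S"
      unfolding closure_iff[OF SG]
      using x subgroup.m_inv_closed[OF sub] by (simp add: group_hom.hom_inv[OF p_hom])
    show "x \<otimes> y \<in> T closure_of S" if "y \<in> T closure_of S"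
    proof -
      have y: "y \<in> carrier G" "\<And>i. i \<in> I \<Longrightarrow> p i y \<in> p i ` S" using that unfolding closure_iff[OF SG] by blast+
      show ?thesis
        unfolding closure_iff[OF SG]
        using x y subgroup.m_closed[OF sub] by (simp add: group_hom.hom_mult[OF p_hom])
    qed
  qed (use closure_of_subset_topspace[of T S] in \<open>simp add: topspace_eq\<close>)
qed

text \<open>By \<open>closure_iff\<close>, an element whose projections all lie in the images of
  \<open>K\<close> lies in the closure of \<open>K\<close>, which is \<open>K\<close>. So
  restricting every \<open>H i\<close> to the image of \<open>K\<close> cuts out exactly
  \<open>K\<close>, with the same indices, transition maps and \<open>f\<close>.\<close>

lemma inverse_limit_of_images:
  assumes K: "subgroup K G" "T closure_of K = K"
  shows "topological_group (G\<lparr>carrier := K\<rparr>) (subtopology T K)"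
    and "inverse_system I leq (\<lambda>i. H i\<lparr>carrier := p i ` K\<rparr>) \<phi>"
    and "topological_iso (G\<lparr>carrier := K\<rparr>) (subtopology T K)
      (inverse_limit_group I leq (\<lambda>i. H i\<lparr>carrier := p i ` K\<rparr>) \<phi>)
      (inverse_limit_topology I leq (\<lambda>i. H i\<lparr>carrier := p i ` K\<rparr>) \<phi>) f"
proof -
  have KG: "K \<subseteq> carrier G" using K(1) by (rule subgroup.subset)
  interpret K: group "G\<lparr>carrier := K\<rparr>" by (rule subgroup_imp_group[OF K(1)])
  show "topological_group (G\<lparr>carrier := K\<rparr>) (subtopology T K)"
  proof
    show "topspace (subtopology T K) = carrier (G\<lparr>carrier := K\<rparr>)"
      using KG topspace_eq by auto
    have "continuous_map (subtopology (prod_topology T T) (K \<times> K)) (subtopology T K) (\<lambda>(x, y). x \<otimes> y)"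
      using continuous_map_from_subtopology[OF continuous_mult, of "K \<times> K"] subgroup.m_closed[OF K(1)]
      by (auto simp: continuous_map_in_subtopology)
    then show "continuous_map (prod_topology (subtopology T K) (subtopology T K)) (subtopology T K)
        (\<lambda>(x, y). x \<otimes>\<^bsub>G\<lparr>carrier := K\<rparr>\<^esub> y)"
      by (simp add: subtopology_Times)
    have "continuous_map (subtopology T K) (subtopology T K) (\<lambda>x. inv x)"
      using continuous_map_from_subtopology[OF continuous_inv, of K] subgroup.m_inv_closed[OF K(1)]
      by (auto simp: continuous_map_in_subtopology)
    then show "continuous_map (subtopology T K) (subtopology T K) (\<lambda>x. inv\<^bsub>G\<lparr>carrier := K\<rparr>\<^esub> x)"
      by (rule continuous_map_eq) (simp add: m_inv_consistent[OF K(1)])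
  qed
  let ?H = "\<lambda>i. H i\<lparr>carrier := p i ` K\<rparr>"
  show "inverse_system I leq ?H \<phi>"
  proof (rule inverse_system.intro)
    show "group (?H i)" if "i \<in> I" for i
      using group.subgroup_imp_group[OF groups[OF that]
          group_hom.subgroup_img_is_subgroup[OF p_hom[OF that] K(1)]] .
    show "\<phi> i j \<in> hom (?H j) (?H i)" if ij: "i \<in> I" "j \<in> I" "i \<preceq> j" for i j
    proof (rule homI)
      show "\<phi> i j x \<in> carrier (?H i)" if "x \<in> carrier (?H j)" for x
        using that KG p_transition[OF ij] by auto
      show "\<phi> i j (x \<otimes>\<^bsub>?H j\<^esub> y) = \<phi> i j x \<otimes>\<^bsub>?H i\<^esub> \<phi> i j y"
        if "x \<in> carrier (?H j)" "y \<in> carrier (?H j)" for x y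
        using that KG p_closed[OF ij(2)] hom_mult[OF transition_hom[OF ij], of x y] by auto
    qed
    show "\<phi> i i x = x" if "i \<in> I" "x \<in> carrier (?H i)" for i x
      using that transition_id KG p_closed by auto
    show "\<phi> i j (\<phi> j k x) = \<phi> i k x"
      if "i \<in> I" "j \<in> I" "k \<in> I" "i \<preceq> j" "j \<preceq> k" "x \<in> carrier (?H k)" for i j k x
      using that transition_comp KG p_closed by auto
  qed (use nonempty partial_order directed in auto)
  define L' where "L' = inverse_limit_carrier I leq ?H \<phi>"
  have L'_eq: "L' = L \<inter> (\<Pi>\<^sub>E i\<in>I. p i ` K)"
  proof -
    have "(\<Pi>\<^sub>E i\<in>I. p i ` K) \<subseteq> (\<Pi>\<^sub>E i\<in>I. carrier (H i))"
      using p_closed KG by (intro PiE_mono) blast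
    then show ?thesis
      unfolding L'_def inverse_limit_carrier_def by auto
  qed
  have mem: "f x \<in> L' \<longleftrightarrow> x \<in> K" if x: "x \<in> carrier G" for x
  proof -
    have "f x \<in> L' \<longleftrightarrow> (\<forall>i\<in>I. p i x \<in> p i ` K)"
      unfolding L'_eq using f_L[OF x] unfolding inverse_limit_carrier_def by (auto simp: PiE_iff p_def)
    also have "\<dots> \<longleftrightarrow> x \<in> K"
      using closure_iff[OF KG, of x] x K(2) by simp
    finally show ?thesis .
  qed
  have "bij_betw f K L'"
    unfolding bij_betw_def
  proof
    show "inj_on f K" using f_bij KG by (auto simp: bij_betw_def intro: inj_on_subset)
    show "f ` K = L'"
    proof
      show "f ` K \<subseteq> L'" using mem KG by blast
      show "L' \<subseteq> f ` K"
      proof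
        fix y assume y: "y \<in> L'"
        then obtain x where "x \<in> carrier G" "y = f x"
          using f_bij unfolding L'_eq bij_betw_def by blast
        then show "y \<in> f ` K" using mem y by blast
      qed
    qed
  qed
  moreover have "f (x \<otimes> y) = (\<lambda>i\<in>I. f x i \<otimes>\<^bsub>H i\<^esub> f y i)" if "x \<in> K" "y \<in> K" for x y
    using that KG by (intro f_mult) auto
  ultimately have "f \<in> iso (G\<lparr>carrier := K\<rparr>) (inverse_limit_group I leq ?H \<phi>)"
    unfolding iso_def hom_def inverse_limit_group_def L'_def[symmetric]
    by (auto simp: bij_betw_def)
  moreover have "homeomorphic_map (subtopology T K) (subtopology (subtopology Y L) L') f"
    using f_homeomorphic by (rule homeomorphic_map_subtopologies_alt) (use mem topspace_eq in auto)
  moreover have "inverse_limit_topology I leq ?H \<phi> = subtopology (subtopology Y L) L'"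
  proof -
    have "product_topology (\<lambda>i. discrete_topology (p i ` K)) I
      = product_topology (\<lambda>i. subtopology (discrete_topology (carrier (H i))) (p i ` K)) I"
    proof (rule product_topology_cong)
      fix i assume "i \<in> I"
      then have "carrier (H i) \<inter> p i ` K = p i ` K"
        using p_closed KG by blast
      then show "discrete_topology (p i ` K) = subtopology (discrete_topology (carrier (H i))) (p i ` K)"
        by simp
    qed
    also have "\<dots> = subtopology Y (\<Pi>\<^sub>E i\<in>I. p i ` K)"
      by (simp only: subtopology_product_topology)
    finally show ?thesis
      unfolding inverse_limit_topology_def L'_def[symmetric]
      by (simp add: subtopology_subtopology L'_eq Int_ac)
  qed
  ultimately show "topological_iso (G\<lparr>carrier := K\<rparr>) (subtopology T K)
      (inverse_limit_group I leq ?H \<phi>) (inverse_limit_topology I leq ?H \<phi>) f"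
    unfolding topological_iso_def by simp
qed

lemma closed_derived_props:
  "subgroup (closed_derived G T n) G"
  "T closure_of (closed_derived G T n) = closed_derived G T n"
proof -
  have "subgroup (closed_derived G T n) G \<and> T closure_of (closed_derived G T n) = closed_derived G T n"
  proof (induction n)
    case 0
    then show ?case using subgroup_self topspace_eq by (metis closed_derived.simps(1) closure_of_topspace)
  next
    case (Suc n)
    then show ?case
      by (simp add: closure_subgroup derived_is_subgroup subgroup.subset)
  qed
  then show "subgroup (closed_derived G T n) G"
    "T closure_of (closed_derived G T n) = closed_derived G T n" by blast+
qed

text \<open>Homomorphisms commute with forming derived subgroups, and the closure does not change
  the image.\<close>

lemma image_closed_derived_Suc:
  assumes "i \<in> I"
  shows "p i ` closed_derived G T (Suc n) = derived (H i) (p i ` closed_derived G T n)"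
proof -
  have "closed_derived G T n \<subseteq> carrier G"
    using closed_derived_props(1) subgroup.subset by blast
  then show ?thesis
    using image_closure[OF derived_in_carrier assms] group_hom.derived_img[OF p_hom[OF assms]] by simp
qed

text \<open>The image of \<open>G\<close> in \<open>H i\<close> is a finite continuous image of a
  compact group, so it inherits the Magnus Property and the finite case applies to it.\<close>

lemma image_second_derived_nilpotent:
  assumes "magnus_property G T" "i \<in> I"
  shows "nilpotent_group (H i\<lparr>carrier := p i ` closed_derived G T 2\<rparr>)"
proof -
  let ?P = "p i ` carrier G"
  let ?Gi = "H i\<lparr>carrier := ?P\<rparr>"
  interpret Hi: group "H i" using groups[OF assms(2)] .
  interpret pi: group_hom G "H i" "p i" by (rule p_hom[OF assms(2)])
  have sub: "subgroup ?P (H i)" by (rule pi.img_is_subgroup)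
  interpret Gi: group ?Gi by (rule Hi.subgroup_imp_group[OF sub])
  have hom: "group_hom G ?Gi (p i)"
    by unfold_locales (auto simp: hom_def)
  have cont: "continuous_map T (discrete_topology (carrier ?Gi)) (p i)"
  proof -
    have "continuous_map T (subtopology (discrete_topology (carrier (H i))) ?P) (p i)"
      unfolding continuous_map_in_subtopology using p_continuous[OF assms(2)] topspace_eq by simp
    then show ?thesis
      using subgroup.subset[OF sub] by (simp add: Int_absorb1)
  qed
  interpret Gi: finite_magnus_group ?Gi
  proof
    show "finite (carrier ?Gi)"
      using finite_subset[OF subgroup.subset[OF sub] finite_quotients[OF assms(2)]] by simp
    show "magnus_property ?Gi (discrete_topology (carrier ?Gi))"
      by (rule magnus_property_image[OF topological_group_axioms compact_T assms(1) hom _ cont]) simp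
  qed
  \<comment> \<open>Derived subgroups come out the same in \<open>H i\<close> and in the image of
    \<open>G\<close>, which matches the finite result with the images of
    \<open>closed_derived\<close>.\<close>
  have d1: "derived ?Gi ?P = derived (H i) ?P"
    by (rule Hi.derived_consistent[OF _ sub]) simp
  moreover have "derived ?Gi (derived (H i) ?P) = derived (H i) (derived (H i) ?P)"
    by (rule Hi.derived_consistent[OF Hi.derived_incl[OF _ sub] sub]) simp
  moreover have "p i ` closed_derived G T 2 = derived (H i) (derived (H i) ?P)"
    using image_closed_derived_Suc[OF assms(2), of 1] image_closed_derived_Suc[OF assms(2), of 0]
    by (simp add: numeral_2_eq_2)
  ultimately show ?thesis
    using Gi.second_derived_nilpotent by simp
qed

end

theorem corollary1p4:
  fixes G :: "('a, 'm) monoid_scheme" and T :: "'a topology"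
  assumes "profinite_group G T"
    and "magnus_property G T"
  shows "pronilpotent_group (G\<lparr>carrier := closed_derived G T 2\<rparr>)
    (subtopology T (closed_derived G T 2))"
proof -
  obtain I :: "'a set set" and leq and H :: "'a set \<Rightarrow> nat monoid" and \<phi> f where *:
    "topological_group G T" "inverse_system I leq H \<phi>" "\<And>i. i \<in> I \<Longrightarrow> finite (carrier (H i))"
    "topological_iso G T (inverse_limit_group I leq H \<phi>) (inverse_limit_topology I leq H \<phi>) f"
    using assms(1) unfolding profinite_group_def inverse_limit_of_finite_def by blast
  interpret profinite_presentation G T I leq H \<phi> f
    by (intro profinite_presentation.intro profinite_presentation_axioms.intro *)
  let ?K = "closed_derived G T 2"
  let ?H = "\<lambda>i. H i\<lparr>carrier := p i ` ?K\<rparr>"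
  \<comment> \<open>The closed subgroup \<open>?K\<close> is the limit of its images; this one
    presentation yields both conjuncts of \<open>pronilpotent_group\<close>.\<close>
  note limit = inverse_limit_of_images[OF closed_derived_props]
  have fin: "finite (carrier (?H i))" if "i \<in> I" for i
  proof -
    have "p i ` ?K \<subseteq> carrier (H i)"
      using p_closed[OF that] subgroup.subset[OF closed_derived_props(1)] by blast
    then show ?thesis using finite_subset[OF _ *(3)[OF that]] by simp
  qed
  have nilp: "nilpotent_group (?H i)" if "i \<in> I" for i
    by (rule image_second_derived_nilpotent[OF assms(2) that])
  have "inverse_limit_of_finite nilpotent_group (G\<lparr>carrier := ?K\<rparr>) (subtopology T ?K)"
    unfolding inverse_limit_of_finite_def
    by (intro conjI exI[of _ I] exI[of _ leq] exI[of _ ?H] exI[of _ \<phi>] exI[of _ f] ballI limit fin nilp)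
  moreover have "inverse_limit_of_finite (\<lambda>_. True) (G\<lparr>carrier := ?K\<rparr>) (subtopology T ?K)"
    unfolding inverse_limit_of_finite_def
    by (intro conjI exI[of _ I] exI[of _ leq] exI[of _ ?H] exI[of _ \<phi>] exI[of _ f] ballI limit fin TrueI)
  ultimately show ?thesis
    unfolding pronilpotent_group_def profinite_group_def by blast
qed

end
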